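(* The space $\mathfrak m\mathrm{Sym}$ is a Hopf subalgebra of $\mathfrak m\mathrm{QSym}$. It is isomorphic to the completion $\widehat{\mathrm{Sym}}=\prod_\lambda\mathbb Z\cdot s_\lambda$ of the algebra of symmetric functions.
   Context: $\mathfrak m\mathrm{QSym}$: for a composition $\alpha=(\alpha_1,\dots,\alpha_k)$ of $n$ let $D(\alpha)=\{\alpha_1,\alpha_1+\alpha_2,\dots,\alpha_1+\cdots+\alpha_{k-1}\}\subset[n-1]$ and choose $w\in S_n$ with descent set $D(\alpha)$. $\tilde L_\alpha\in\mathbb Z[[x_1,x_2,\dots]]$ is the sum, over all sequences $(\sigma_1,\dots,\sigma_n)$ of nonempty finite sets of positive integers with $\max\sigma_i\le\min\sigma_{i+1}$ if $w_i<w_{i+1}$ and $\max\sigma_i<\min\sigma_{i+1}$ if $w_i>w_{i+1}$, of $\prod_i\prod_{r\in\sigma_i}x_r$. $\mathfrak m\mathrm{QSym}=\prod_\alpha\mathbb Z\tilde L_\alpha$ is the Hopf algebra of arbitrary (possibly infinite) $\mathbb Z$-linear combinations of the $\tilde L_\alpha$ over all compositions, with the product of power series and the coproduct $f(x)\mapsto f(x,y)$ (evaluation on the ordered variables $x_1<x_2<\cdots<y_1<y_2<\cdots$, in the completed tensor square). $\mathfrak m\mathrm{Sym}$: for a partition $\lambda$ (Young diagram in English notation), a set-valued tableau of shape $\lambda$ is a filling of the boxes with nonempty finite sets of positive integers such that, for a box $s$ with box $t$ immediately to its right, $\max(s)\le\min(t)$, and for a box $s$ with box $t$ immediately below it, $\max(s)<\min(t)$.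 $\tilde K_\lambda=\sum_T x^T$ over all set-valued tableaux $T$ of shape $\lambda$, where $x^T=\prod_i x_i^{a_i}$ and $a_i$ is the number of boxes whose set contains $i$. $\mathfrak m\mathrm{Sym}=\prod_\lambda\mathbb Z\cdot\tilde K_\lambda$ is the subspace of $\mathfrak m\mathrm{QSym}$ of arbitrary $\mathbb Z$-linear combinations of the $\tilde K_\lambda$, $\lambda$ ranging over all partitions. $\mathrm{Sym}$ is the Hopf algebra of symmetric functions over $\mathbb Z$ with Schur basis $s_\lambda$; $\widehat{\mathrm{Sym}}$ is the space of arbitrary linear combinations of Schur functions with the Hopf structure extended continuously. *)

theory Defs
  imports "HOL-Analysis.Analysis" "HOL-Library.Multiset"
begin

section \<open>Power series\<close>

text \<open>
  A formal power series over the integers is its coefficient function. Monomials in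
  \<open>x\<^sub>1, x\<^sub>2, \<dots>\<close> are multisets of naturals, the natural number \<open>i\<close> standing for the variable
  \<open>x\<^bsub>i+1\<^esub>\<close>; only the order of the variables matters. Series in two alphabets \<open>x, y\<close> have pairs
  of such multisets as monomials. Function spaces carry the product topology with \<open>int\<close>
  discrete, which is the topology of coefficientwise convergence.
\<close>

type_synonym 'm series = "'m \<Rightarrow> int"
type_synonym xseries = "nat multiset series"
type_synonym xyseries = "(nat multiset \<times> nat multiset) series"

definition series_add :: "'m series \<Rightarrow> 'm series \<Rightarrow> 'm series"  (infixl \<open>\<oplus>\<^sub>s\<close> 65) where
  "f \<oplus>\<^sub>s g = (\<lambda>m. f m + g m)"

definition series_mult :: "'m::monoid_add series \<Rightarrow> 'm series \<Rightarrow> 'm series"  (infixl \<open>\<otimes>\<^sub>s\<close> 70) where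
  "f \<otimes>\<^sub>s g = (\<lambda>m. \<Sum>(a, b)\<in>{(a, b). a + b = m}. f a * g b)"

definition series_const :: "int \<Rightarrow> 'm::zero series" where
  "series_const c = (\<lambda>m. if m = 0 then c else 0)"

definition tensor :: "xseries \<Rightarrow> xseries \<Rightarrow> xyseries" where
  "tensor f g = (\<lambda>(a, b). f a * g b)"


section \<open>Completed Hopf algebras of power series\<close>

text \<open>
  \<open>\<lparr>index = I, basis = u\<rparr>\<close> represents \<open>\<Prod>\<^bsub>i\<in>I\<^esub> \<int> u\<^sub>i\<close>, the space of arbitrary, possibly infinite,
  linear combinations of the \<open>u\<^sub>i\<close>. For the families used here the defining infinite sums are finite
  in each coefficient, so that all coefficient families are allowed (lemma
  \<open>all_combinations_exist\<close> below). Each \<open>u\<^sub>i\<close> has a lowest degree part, of degree the size of \<open>i\<close>,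
  and these parts are linearly independent (fundamental quasisymmetric and Schur functions), so the
  topology of coefficientwise convergence is also the product topology of \<open>\<Prod>\<^bsub>i\<in>I\<^esub> \<int> u\<^sub>i\<close>.
\<close>

record 'i based_space =
  index :: "'i set"
  basis :: "'i \<Rightarrow> xseries"

definition lincombs :: "'i set \<Rightarrow> ('i \<Rightarrow> 'm series) \<Rightarrow> 'm series set" where
  "lincombs I u = {f. \<exists>c :: 'i \<Rightarrow> int. \<forall>m. ((\<lambda>i. c i * u i m) has_sum f m) I}"

definition space_of :: "'i based_space \<Rightarrow> xseries set" where
  "space_of M = lincombs (index M) (basis M)"

definition tensor_square :: "'i based_space \<Rightarrow> xyseries set" where
  "tensor_square M =
     lincombs (index M \<times> index M) (\<lambda>(i, j). tensor (basis M i) (basis M j))"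

text \<open>
  The coproduct is \<open>f(x) \<mapsto> f(x,y)\<close> on the ordered alphabet \<open>x\<^sub>1 < x\<^sub>2 < \<dots> < y\<^sub>1 < y\<^sub>2 < \<dots>\<close>. The
  coefficient at \<open>x\<^sup>a y\<^sup>b\<close> is read off from \<open>f(x\<^sub>1, \<dots>, x\<^sub>N, y\<^sub>1, y\<^sub>2, \<dots>)\<close>, where \<open>N\<close> is large enough
  for \<open>x\<^sup>a\<close> to involve only \<open>x\<^sub>1, \<dots>, x\<^sub>N\<close>. Lemma \<open>coproduct_eq\<close> below shows that on quasisymmetric
  functions every such \<open>N\<close> gives the same result.
\<close>

definition var_bound :: "nat multiset \<Rightarrow> nat" where
  "var_bound a = (LEAST N. \<forall>i\<in>#a. i < N)"

definition coproduct :: "xseries \<Rightarrow> xyseries" where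
  "coproduct f = (\<lambda>(a, b). f (a + image_mset (\<lambda>j. var_bound a + j) b))"

definition counit :: "xseries \<Rightarrow> int" where
  "counit f = f {#}"

text \<open>
  \<open>tensor_id S\<close> is \<open>S \<otimes> id\<close> and \<open>id_tensor S\<close> is \<open>id \<otimes> S\<close>: a two-alphabet series is a family of
  series in \<open>x\<close>, one for each monomial in \<open>y\<close>, and \<open>S\<close> is applied to each of them (and vice versa).
  For continuous linear \<open>S\<close> this is the continuous extension of \<open>f(x) g(y) \<mapsto> (S f) g(y)\<close> to the
  completed tensor square.
\<close>

definition tensor_id ::
  "(xseries \<Rightarrow> 'p series) \<Rightarrow> xyseries \<Rightarrow> ('p \<times> nat multiset) series" where
  "tensor_id S F = (\<lambda>(p, b). S (\<lambda>a. F (a, b)) p)"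

definition id_tensor ::
  "(xseries \<Rightarrow> 'p series) \<Rightarrow> xyseries \<Rightarrow> (nat multiset \<times> 'p) series" where
  "id_tensor S F = (\<lambda>(a, p). S (\<lambda>b. F (a, b)) p)"

text \<open>
  The product as a map on the completed tensor square, \<open>f(x) g(y) \<mapsto> f(x) g(x)\<close>, i.e. the
  substitution \<open>y := x\<close>.
\<close>

definition codiagonal :: "xyseries \<Rightarrow> xseries" where
  "codiagonal F = (\<lambda>m. \<Sum>(a, b)\<in>{(a, b). a + b = m}. F (a, b))"

definition continuous_linear_on :: "xseries set \<Rightarrow> (xseries \<Rightarrow> xseries) \<Rightarrow> bool" where
  "continuous_linear_on A S \<longleftrightarrow>
     (\<forall>f\<in>A. \<forall>g\<in>A. S (f \<oplus>\<^sub>s g) = S f \<oplus>\<^sub>s S g) \<and> continuous_on A S"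

definition is_antipode :: "'i based_space \<Rightarrow> (xseries \<Rightarrow> xseries) \<Rightarrow> bool" where
  "is_antipode M S \<longleftrightarrow>
     S \<in> space_of M \<rightarrow> space_of M \<and>
     continuous_linear_on (space_of M) S \<and>
     (\<forall>f\<in>space_of M.
        codiagonal (tensor_id S (coproduct f)) = series_const (counit f) \<and>
        codiagonal (id_tensor S (coproduct f)) = series_const (counit f))"

definition hopf_algebra :: "'i based_space \<Rightarrow> bool" where
  "hopf_algebra M \<longleftrightarrow>
     series_const 1 \<in> space_of M \<and>
     (\<forall>f\<in>space_of M. \<forall>g\<in>space_of M. f \<otimes>\<^sub>s g \<in> space_of M) \<and>
     (\<forall>f\<in>space_of M. coproduct f \<in> tensor_square M) \<and>
     (\<forall>f\<in>space_of M. \<forall>a b c.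
        tensor_id coproduct (coproduct f) ((a, b), c) =
        id_tensor coproduct (coproduct f) (a, (b, c))) \<and>
     (\<forall>f\<in>space_of M.
        (\<lambda>b. counit (\<lambda>a. coproduct f (a, b))) = f \<and>
        (\<lambda>a. counit (\<lambda>b. coproduct f (a, b))) = f) \<and>
     coproduct (series_const 1) = series_const 1 \<and>
     (\<forall>f\<in>space_of M. \<forall>g\<in>space_of M. coproduct (f \<otimes>\<^sub>s g) = coproduct f \<otimes>\<^sub>s coproduct g) \<and>
     counit (series_const 1) = 1 \<and>
     (\<forall>f\<in>space_of M. \<forall>g\<in>space_of M. counit (f \<otimes>\<^sub>s g) = counit f * counit g) \<and>
     (\<exists>S. is_antipode M S)"

definition hopf_subalgebra :: "'i based_space \<Rightarrow> 'j based_space \<Rightarrow> bool" where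
  "hopf_subalgebra M H \<longleftrightarrow>
     hopf_algebra H \<and>
     space_of M \<subseteq> space_of H \<and>
     series_const 1 \<in> space_of M \<and>
     (\<forall>f\<in>space_of M. \<forall>g\<in>space_of M. f \<otimes>\<^sub>s g \<in> space_of M) \<and>
     (\<forall>f\<in>space_of M. coproduct f \<in> tensor_square M) \<and>
     (\<forall>S. is_antipode H S \<longrightarrow> S ` space_of M \<subseteq> space_of M)"

definition hopf_isomorphism ::
  "'i based_space \<Rightarrow> 'j based_space \<Rightarrow> (xseries \<Rightarrow> xseries) \<Rightarrow> bool" where
  "hopf_isomorphism M N \<phi> \<longleftrightarrow>
     (\<exists>\<psi>. homeomorphism (space_of M) (space_of N) \<phi> \<psi>) \<and>
     continuous_linear_on (space_of M) \<phi> \<and>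
     \<phi> (series_const 1) = series_const 1 \<and>
     (\<forall>f\<in>space_of M. \<forall>g\<in>space_of M. \<phi> (f \<otimes>\<^sub>s g) = \<phi> f \<otimes>\<^sub>s \<phi> g) \<and>
     (\<forall>f\<in>space_of M. coproduct (\<phi> f) = tensor_id \<phi> (id_tensor \<phi> (coproduct f))) \<and>
     (\<forall>f\<in>space_of M. counit (\<phi> f) = counit f) \<and>
     (\<forall>S S'. is_antipode M S \<and> is_antipode N S' \<longrightarrow> (\<forall>f\<in>space_of M. \<phi> (S f) = S' (\<phi> f)))"

definition hopf_isomorphic :: "'i based_space \<Rightarrow> 'j based_space \<Rightarrow> bool" where
  "hopf_isomorphic M N \<longleftrightarrow> hopf_algebra M \<and> hopf_algebra N \<and> (\<exists>\<phi>. hopf_isomorphism M N \<phi>)"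


section \<open>Generating functions of set-valued fillings\<close>

text \<open>
  The sum of \<open>\<Prod>\<^bsub>b\<in>B\<^esub> \<Prod>\<^bsub>r\<in>T b\<^esub> x\<^sub>r\<close> over the fillings \<open>T\<close> of \<open>B\<close> by nonempty finite sets that
  satisfy \<open>P\<close>.
\<close>

definition set_valued_series :: "'b set \<Rightarrow> (('b \<Rightarrow> nat set) \<Rightarrow> bool) \<Rightarrow> xseries" where
  "set_valued_series B P = (\<lambda>m. int (card
     {T \<in> B \<rightarrow>\<^sub>E {A. finite A \<and> A \<noteq> {}}. P T \<and> (\<Sum>b\<in>B. mset_set (T b)) = m}))"


section \<open>Multi-quasisymmetric functions\<close>

definition compositions :: "nat list set" where
  "compositions = {\<alpha>. \<forall>k\<in>set \<alpha>. k > 0}"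

definition partial_sums :: "nat list \<Rightarrow> nat set" where
  "partial_sums \<alpha> = {sum_list (take i \<alpha>) |i. 1 \<le> i \<and> i < length \<alpha>}"

definition descents :: "nat \<Rightarrow> (nat \<Rightarrow> nat) \<Rightarrow> nat set" where
  "descents n w = {i. 1 \<le> i \<and> i < n \<and> w i > w (i + 1)}"

definition perm_of_composition :: "nat list \<Rightarrow> nat \<Rightarrow> nat" where
  "perm_of_composition \<alpha> =
     (SOME w. w permutes {1..sum_list \<alpha>} \<and> descents (sum_list \<alpha>) w = partial_sums \<alpha>)"

definition set_valued_partition :: "nat \<Rightarrow> (nat \<Rightarrow> nat) \<Rightarrow> (nat \<Rightarrow> nat set) \<Rightarrow> bool" where
  "set_valued_partition n w \<sigma> \<longleftrightarrow> (\<forall>i. 1 \<le> i \<and> i < n \<longrightarrow>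
     (w i < w (i + 1) \<longrightarrow> Max (\<sigma> i) \<le> Min (\<sigma> (i + 1))) \<and>
     (w i > w (i + 1) \<longrightarrow> Max (\<sigma> i) < Min (\<sigma> (i + 1))))"

definition Ltilde :: "nat list \<Rightarrow> xseries" where
  "Ltilde \<alpha> = set_valued_series {1..sum_list \<alpha>}
     (set_valued_partition (sum_list \<alpha>) (perm_of_composition \<alpha>))"

definition mQSym :: "nat list based_space" where
  "mQSym = \<lparr>index = compositions, basis = Ltilde\<rparr>"


section \<open>Multi-symmetric and symmetric functions\<close>

definition partitions :: "nat list set" where
  "partitions = {\<mu>. sorted_wrt (\<ge>) \<mu> \<and> (\<forall>k\<in>set \<mu>. k > 0)}"

text \<open>The box \<open>(i, j)\<close> is in row \<open>i\<close> (counted downwards) and column \<open>j\<close>, both starting at \<open>0\<close>.\<close>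

definition boxes :: "nat list \<Rightarrow> (nat \<times> nat) set" where
  "boxes \<mu> = {(i, j). i < length \<mu> \<and> j < \<mu> ! i}"

definition set_valued_tableau :: "nat list \<Rightarrow> (nat \<times> nat \<Rightarrow> nat set) \<Rightarrow> bool" where
  "set_valued_tableau \<mu> T \<longleftrightarrow> (\<forall>i j. (i, j) \<in> boxes \<mu> \<longrightarrow>
     ((i, j + 1) \<in> boxes \<mu> \<longrightarrow> Max (T (i, j)) \<le> Min (T (i, j + 1))) \<and>
     ((i + 1, j) \<in> boxes \<mu> \<longrightarrow> Max (T (i, j)) < Min (T (i + 1, j))))"

definition Ktilde :: "nat list \<Rightarrow> xseries" where
  "Ktilde \<mu> = set_valued_series (boxes \<mu>) (set_valued_tableau \<mu>)"

definition mSym :: "nat list based_space" where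
  "mSym = \<lparr>index = partitions, basis = Ktilde\<rparr>"

definition semistandard_tableau :: "nat list \<Rightarrow> (nat \<times> nat \<Rightarrow> nat) \<Rightarrow> bool" where
  "semistandard_tableau \<mu> T \<longleftrightarrow> (\<forall>i j. (i, j) \<in> boxes \<mu> \<longrightarrow>
     ((i, j + 1) \<in> boxes \<mu> \<longrightarrow> T (i, j) \<le> T (i, j + 1)) \<and>
     ((i + 1, j) \<in> boxes \<mu> \<longrightarrow> T (i, j) < T (i + 1, j)))"

definition schur :: "nat list \<Rightarrow> xseries" where
  "schur \<mu> = (\<lambda>m. int (card
     {T \<in> boxes \<mu> \<rightarrow>\<^sub>E UNIV. semistandard_tableau \<mu> T \<and> image_mset T (mset_set (boxes \<mu>)) = m}))"

text \<open>
  The Hopf structure of symmetric functions is given by the product of power series and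
  \<open>f(x) \<mapsto> f(x,y)\<close>. Both are continuous for coefficientwise convergence (lemmas
  \<open>continuous_series_mult\<close> and \<open>continuous_coproduct\<close>), so the same formulas give the continuous
  extension to infinite linear combinations of Schur functions.
\<close>

definition Sym_hat :: "nat list based_space" where
  "Sym_hat = \<lparr>index = partitions, basis = schur\<rparr>"


section \<open>Well-definedness of the above conventions\<close>

lemma continuous_series_mult:
  "continuous_on UNIV (\<lambda>(f, g). f \<otimes>\<^sub>s g :: 'm::monoid_add series)"
  unfolding series_mult_def case_prod_unfold
  by (intro continuous_on_coordinatewise_then_product continuous_intros
        continuous_on_product_then_coordinatewise[OF continuous_on_fst[OF continuous_on_id]]
        continuous_on_product_then_coordinatewise[OF continuous_on_snd[OF continuous_on_id]])

lemma continuous_coproduct: "continuous_on UNIV coproduct"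
  unfolding coproduct_def case_prod_unfold
  by (intro continuous_on_coordinatewise_then_product
        continuous_on_product_then_coordinatewise[OF continuous_on_id])

lemma ex_perm_descents:
  assumes "D \<subseteq> {1..<n}"
  shows "\<exists>w. w permutes {1..n} \<and> descents n w = D"
proof -
  define d where "d = (\<lambda>i::nat. card {j \<in> D. i \<le> j})"
  define r where "r = (\<lambda>i j. d i < d j \<or> (d i = d j \<and> i < j))"
  define v where "v = (\<lambda>i. Suc (card {j \<in> {1..n}. r j i}))"
  define w where "w = (\<lambda>i. if i \<in> {1..n} then v i else i)"
  have finD: "finite D"
    using assms finite_subset by blast
  have v_less: "v i < v k" if "r i k" "i \<in> {1..n}" for i k
  proof -
    have "{j \<in> {1..n}. r j i} \<subset> {j \<in> {1..n}. r j k}"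
      using that unfolding r_def by fastforce
    then have "card {j \<in> {1..n}. r j i} < card {j \<in> {1..n}. r j k}"
      by (intro psubset_card_mono) auto
    then show ?thesis unfolding v_def by simp
  qed
  have total: "r i k \<or> r k i" if "i \<noteq> k" for i k
    using that unfolding r_def by auto
  have inj: "inj_on v {1..n}"
  proof (rule inj_onI, rule ccontr)
    fix i k assume "i \<in> {1..n}" "k \<in> {1..n}" "v i = v k" "i \<noteq> k"
    then show False
      using total[of i k] v_less[of i k] v_less[of k i] by linarith
  qed
  have range: "v i \<in> {1..n}" if "i \<in> {1..n}" for i
  proof -
    have "\<not> r i i"
      unfolding r_def by simp
    then have "{j \<in> {1..n}. r j i} \<subset> {1..n}"
      using that by blast
    then have "card {j \<in> {1..n}. r j i} < card {1..n}"
      by (intro psubset_card_mono) auto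
    then show ?thesis unfolding v_def by simp
  qed
  have "v ` {1..n} \<subseteq> {1..n}"
    using range by blast
  then have "bij_betw v {1..n} {1..n}"
    using inj by (simp add: bij_betw_def endo_inj_surj)
  then have "bij_betw w {1..n} {1..n}"
    by (subst bij_betw_cong[of _ w v]) (auto simp: w_def)
  then have perm: "w permutes {1..n}"
    by (rule bij_imp_permutes) (auto simp: w_def)
  have "w i > w (i + 1) \<longleftrightarrow> i \<in> D" if "1 \<le> i" "i < n" for i
  proof -
    have eq: "{j \<in> D. i \<le> j} = {j \<in> D. i + 1 \<le> j} \<union> (D \<inter> {i})"
      by auto
    have "d i = d (i + 1) + card (D \<inter> {i})"
      unfolding d_def by (subst eq, subst card_Un_disjoint) (use finD in auto)
    then have "d i = d (i + 1) + (if i \<in> D then 1 else 0)"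
      by auto
    then have "if i \<in> D then r (i + 1) i else r i (i + 1)"
      unfolding r_def by auto
    then show ?thesis
      using that v_less[of i "i + 1"] v_less[of "i + 1" i]
      by (auto simp: w_def split: if_splits)
  qed
  then have "descents n w = D"
    using assms unfolding descents_def by auto
  with perm show ?thesis by blast
qed

lemma perm_of_composition:
  assumes "\<alpha> \<in> compositions"
  shows "perm_of_composition \<alpha> permutes {1..sum_list \<alpha>}"
    and "descents (sum_list \<alpha>) (perm_of_composition \<alpha>) = partial_sums \<alpha>"
proof -
  have "1 \<le> sum_list (take i \<alpha>) \<and> sum_list (take i \<alpha>) < sum_list \<alpha>"
    if "1 \<le> i" "i < length \<alpha>" for i
  proof -
    have pos: "\<alpha> ! k > 0" if "k < length \<alpha>" for k
      using assms that unfolding compositions_def by auto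
    have "sum_list \<alpha> = sum_list (take i \<alpha>) + sum_list (drop i \<alpha>)"
      by (metis append_take_drop_id sum_list_append)
    moreover have "drop i \<alpha> = \<alpha> ! i # drop (Suc i) \<alpha>"
      using that by (simp add: Cons_nth_drop_Suc)
    moreover have "take i \<alpha> = \<alpha> ! 0 # take (i - 1) (tl \<alpha>)"
      using that by (cases \<alpha>; cases i) auto
    moreover have "\<alpha> ! 0 > 0"
      by (rule pos) (use that in linarith)
    ultimately show ?thesis
      using pos[of i] that by simp
  qed
  then have "partial_sums \<alpha> \<subseteq> {1..<sum_list \<alpha>}"
    unfolding partial_sums_def by auto
  from someI_ex[OF ex_perm_descents[OF this]]
  show "perm_of_composition \<alpha> permutes {1..sum_list \<alpha>}"
    and "descents (sum_list \<alpha>) (perm_of_composition \<alpha>) = partial_sums \<alpha>"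
    unfolding perm_of_composition_def by blast+
qed

lemma set_valued_series_image:
  fixes g :: "nat \<Rightarrow> nat"
  assumes g: "strict_mono g"
    and B: "finite B"
    and P: "\<And>T. T \<in> B \<rightarrow>\<^sub>E {A. finite A \<and> A \<noteq> {}} \<Longrightarrow> P (\<lambda>b\<in>B. g ` T b) \<longleftrightarrow> P T"
  shows "set_valued_series B P (image_mset g m) = set_valued_series B P m"
proof -
  define F where "F = (\<lambda>T. \<lambda>b\<in>B. g ` T b)"
  define X where "X = (\<lambda>m. {T \<in> B \<rightarrow>\<^sub>E {A. finite A \<and> A \<noteq> {}}. P T \<and> (\<Sum>b\<in>B. mset_set (T b)) = m})"
  have inj: "inj g"
    using g by (simp add: strict_mono_imp_inj_on)
  have sum: "(\<Sum>b\<in>B. mset_set (F T b)) = image_mset g (\<Sum>b\<in>B. mset_set (T b))" for T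
  proof -
    have "image_mset g (\<Sum>b\<in>B. mset_set (T b)) = (\<Sum>b\<in>B. image_mset g (mset_set (T b)))"
      using B by induction auto
    also have "\<dots> = (\<Sum>b\<in>B. mset_set (F T b))"
      by (intro sum.cong) (auto simp: F_def image_mset_mset_set[OF inj_on_subset[OF inj]])
    finally show ?thesis ..
  qed
  have injF: "inj_on F (X m)"
  proof (rule inj_onI)
    fix T T' assume T: "T \<in> X m" "T' \<in> X m" "F T = F T'"
    show "T = T'"
    proof (rule PiE_ext)
      show "T \<in> B \<rightarrow>\<^sub>E {A. finite A \<and> A \<noteq> {}}" "T' \<in> B \<rightarrow>\<^sub>E {A. finite A \<and> A \<noteq> {}}"
        using T by (auto simp: X_def)
      fix b assume "b \<in> B"
      then have "g ` T b = g ` T' b"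
        using fun_cong[OF T(3), of b] by (simp add: F_def)
      then show "T b = T' b"
        using inj by (simp add: inj_image_eq_iff)
    qed
  qed
  have "F ` X m = X (image_mset g m)"
  proof (intro equalityI subsetI)
    fix U assume "U \<in> F ` X m"
    then obtain T where T: "T \<in> X m" and U: "U = F T" by blast
    then show "U \<in> X (image_mset g m)"
      using sum[of T] P[of T] unfolding X_def F_def by auto
  next
    fix U assume U: "U \<in> X (image_mset g m)"
    define T where "T = (\<lambda>b\<in>B. g -` U b)"
    have fin: "finite (U b)" "U b \<noteq> {}" if "b \<in> B" for b
      using U that unfolding X_def by auto
    have sub: "U b \<subseteq> range g" if "b \<in> B" for b
    proof
      fix x assume "x \<in> U b"
      then have "x \<in># mset_set (U b)"
        using fin that by simp
      then have "x \<in># (\<Sum>b\<in>B. mset_set (U b))"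
        using B that by (auto simp: set_mset_sum)
      then show "x \<in> range g"
        using U unfolding X_def by auto
    qed
    have img: "g ` T b = U b" if "b \<in> B" for b
      using sub[OF that] that by (auto simp: T_def)
    have TPi: "T \<in> B \<rightarrow>\<^sub>E {A. finite A \<and> A \<noteq> {}}"
    proof (rule PiE_I)
      fix b assume b: "b \<in> B"
      have "finite (T b)"
        using fin(1)[OF b] img[OF b] inj by (metis finite_imageD inj_on_subset subset_UNIV)
      moreover have "T b \<noteq> {}"
        using fin(2)[OF b] img[OF b] by auto
      ultimately show "T b \<in> {A. finite A \<and> A \<noteq> {}}" by simp
    qed (simp add: T_def)
    have FT: "F T = U"
    proof (rule PiE_ext[of _ B "\<lambda>_. UNIV"])
      show "F T \<in> B \<rightarrow>\<^sub>E UNIV" by (simp add: F_def)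
      show "U \<in> B \<rightarrow>\<^sub>E UNIV" using U by (auto simp: X_def)
    qed (simp add: F_def img)
    have "image_mset g (\<Sum>b\<in>B. mset_set (T b)) = image_mset g m"
      using sum[of T] U FT by (simp add: X_def)
    then have "(\<Sum>b\<in>B. mset_set (T b)) = m"
      using inj by (metis multiset.inj_map injD)
    moreover have "P T"
      using P[OF TPi] FT U unfolding F_def X_def by auto
    ultimately have "T \<in> X m"
      using TPi unfolding X_def by auto
    then show "U \<in> F ` X m"
      using FT by blast
  qed
  with injF have "card (X (image_mset g m)) = card (X m)"
    by (metis card_image)
  then show ?thesis
    unfolding set_valued_series_def X_def by simp
qed

lemma Ltilde_image:
  assumes "strict_mono g"
  shows "Ltilde \<alpha> (image_mset g m) = Ltilde \<alpha> m"
  unfolding Ltilde_def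
proof (rule set_valued_series_image[OF assms])
  let ?n = "sum_list \<alpha>"
  fix T :: "nat \<Rightarrow> nat set"
  assume T: "T \<in> {1..?n} \<rightarrow>\<^sub>E {A. finite A \<and> A \<noteq> {}}"
  have Max: "Max (g ` T i) = g (Max (T i))" and Min: "Min (g ` T i) = g (Min (T i))"
    if "1 \<le> i" "i \<le> ?n" for i
  proof -
    have "finite (T i)" "T i \<noteq> {}"
      using PiE_mem[OF T, of i] that by auto
    then show "Max (g ` T i) = g (Max (T i))" "Min (g ` T i) = g (Min (T i))"
      using strict_mono_mono[OF assms] by (simp_all add: mono_Max_commute mono_Min_commute)
  qed
  show "set_valued_partition ?n (perm_of_composition \<alpha>) (\<lambda>b\<in>{1..?n}. g ` T b) \<longleftrightarrow>
        set_valued_partition ?n (perm_of_composition \<alpha>) T"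
    unfolding set_valued_partition_def
    by (intro iff_allI imp_cong refl)
      (auto simp: Max Min strict_mono_less[OF assms] strict_mono_less_eq[OF assms])
qed simp

lemma mQSym_image:
  assumes "f \<in> space_of mQSym" and "strict_mono g"
  shows "f (image_mset g m) = f m"
proof -
  from assms(1) obtain c where "((\<lambda>\<alpha>. c \<alpha> * Ltilde \<alpha> m) has_sum f m) compositions" for m
    unfolding space_of_def lincombs_def mQSym_def by auto
  from this[of m] this[of "image_mset g m"] show ?thesis
    unfolding Ltilde_image[OF assms(2)] by (rule has_sum_unique[symmetric])
qed

lemma coproduct_eq:
  assumes "f \<in> space_of mQSym" and N: "\<forall>i\<in>#a. i < N"
  shows "coproduct f (a, b) = f (a + image_mset (\<lambda>j. N + j) b)"
proof -
  define M where "M = var_bound a"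
  define g where "g = (\<lambda>i. if i < M then i else i + (N - M))"
  have less: "\<forall>i\<in>#a. i < M"
    unfolding M_def var_bound_def using N by (rule LeastI)
  have "M \<le> N"
    unfolding M_def var_bound_def using N by (rule Least_le)
  have "strict_mono g"
    unfolding g_def by (rule strict_monoI) auto
  have "image_mset g a = a"
    using less by (simp add: g_def cong: image_mset_cong)
  moreover have "image_mset g (image_mset (\<lambda>j. M + j) b) = image_mset (\<lambda>j. N + j) b"
    using \<open>M \<le> N\<close> unfolding multiset.map_comp by (intro image_mset_cong) (simp add: g_def)
  ultimately have "f (a + image_mset (\<lambda>j. N + j) b) =
      f (image_mset g (a + image_mset (\<lambda>j. M + j) b))"
    by simp
  also have "\<dots> = f (a + image_mset (\<lambda>j. M + j) b)"
    using assms(1) \<open>strict_mono g\<close> by (rule mQSym_image)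
  finally show ?thesis
    unfolding coproduct_def M_def by simp
qed

lemma set_valued_series_eq_0:
  assumes "finite B" "size m < card B"
  shows "set_valued_series B P m = 0"
proof -
  have "size m \<ge> card B"
    if T: "T \<in> B \<rightarrow>\<^sub>E {A. finite A \<and> A \<noteq> {}}" "(\<Sum>b\<in>B. mset_set (T b)) = m" for T :: "_ \<Rightarrow> nat set"
  proof -
    have "card B = (\<Sum>b\<in>B. 1)" by simp
    also have "\<dots> \<le> (\<Sum>b\<in>B. card (T b))"
    proof (rule sum_mono)
      fix b assume "b \<in> B"
      then have "finite (T b)" "T b \<noteq> {}"
        using PiE_mem[OF T(1)] by auto
      then show "1 \<le> card (T b)"
        by (simp add: Suc_leI card_gt_0_iff)
    qed
    also have "\<dots> = size m"
      unfolding T(2)[symmetric] by (simp add: size_multiset_sum)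
    finally show ?thesis .
  qed
  then have "{T \<in> B \<rightarrow>\<^sub>E {A. finite A \<and> A \<noteq> {}}. P T \<and> (\<Sum>b\<in>B. mset_set (T b)) = m} = {}"
    using assms(2) by (auto simp: not_less)
  then show ?thesis
    unfolding set_valued_series_def by (metis card.empty of_nat_0)
qed

lemma boxes_Sigma: "boxes \<mu> = Sigma {..<length \<mu>} (\<lambda>i. {..<\<mu> ! i})"
  unfolding boxes_def by auto

lemma card_boxes: "card (boxes \<mu>) = sum_list \<mu>"
  unfolding boxes_Sigma by (simp add: sum_list_sum_nth atLeast0LessThan)

lemma finite_compositions_le: "finite {\<alpha> \<in> compositions. sum_list \<alpha> \<le> n}"
proof (rule finite_subset)
  have "length \<alpha> \<le> sum_list \<alpha>" if "\<forall>k\<in>set \<alpha>. k > 0" for \<alpha> :: "nat list"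
    using that by (induction \<alpha>) auto
  moreover have "k \<le> sum_list \<alpha>" if "k \<in> set \<alpha>" for k and \<alpha> :: "nat list"
    using that by (simp add: member_le_sum_list)
  ultimately show "{\<alpha> \<in> compositions. sum_list \<alpha> \<le> n} \<subseteq> {\<alpha>. set \<alpha> \<subseteq> {..n} \<and> length \<alpha> \<le> n}"
    unfolding compositions_def by (fastforce intro: order_trans)
qed (simp add: finite_lists_length_le)

lemma all_combinations_exist:
  assumes "M \<in> {mQSym, mSym, Sym_hat}"
  shows "\<exists>f. \<forall>m. ((\<lambda>i. c i * basis M i m) has_sum f m) (index M)"
proof -
  have sub: "index M \<subseteq> compositions"
    using assms by (auto simp: mQSym_def mSym_def Sym_hat_def partitions_def compositions_def)
  have "basis M i m = 0" if "size m < sum_list i" for i m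
  proof -
    have "finite (boxes i)" by (simp add: boxes_Sigma)
    moreover have "schur i m = 0"
    proof -
      have "image_mset T (mset_set (boxes i)) \<noteq> m" for T :: "_ \<Rightarrow> nat"
        using that by (auto simp: card_boxes)
      then show ?thesis by (simp add: schur_def)
    qed
    ultimately show ?thesis
      using assms that
      by (auto simp: mQSym_def mSym_def Sym_hat_def Ltilde_def Ktilde_def card_boxes
          intro!: set_valued_series_eq_0)
  qed
  then have zero: "{i \<in> index M. basis M i m \<noteq> 0} \<subseteq> {\<alpha> \<in> compositions. sum_list \<alpha> \<le> size m}" for m
    using sub by (force simp: not_less[symmetric])
  have "((\<lambda>i. c i * basis M i m) has_sum
      (\<Sum>i\<in>{i \<in> index M. basis M i m \<noteq> 0}. c i * basis M i m)) (index M)" for m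
    by (rule has_sum_finite_neutralI)
      (use finite_subset[OF zero finite_compositions_le] in auto)
  then show ?thesis by (intro exI allI)
qed

end

theory Submission
  imports Defs
begin

text \<open>
  All spaces involved are spaces of invariant power series. The lowest monomials of \<open>L\<^sub>\<alpha>\<close>, \<open>K\<^sub>\<lambda>\<close> and
  \<open>s\<^sub>\<lambda>\<close> (with respect to degree, then to the sum of the indices of the variables) are \<open>x\<^sup>\<alpha>\<close> and
  \<open>x\<^sup>\<lambda>\<close>, with coefficient \<open>1\<close>. By unitriangularity the \<open>L\<^sub>\<alpha>\<close> span all quasisymmetric series, and,
  once \<open>K\<^sub>\<lambda>\<close> is known to be symmetric, both the \<open>K\<^sub>\<lambda>\<close> and the \<open>s\<^sub>\<lambda>\<close> span all symmetric series of
  possibly unbounded degree. So the two spaces of symmetric series are literally equal, and the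
  isomorphism is the identity. Symmetry of \<open>K\<^sub>\<lambda>\<close> follows from a Bender--Knuth involution on
  set-valued tableaux. The antipode is given by recursion on the degree of monomials, which also
  shows that it is unique and that it preserves symmetric series.
\<close>

section \<open>Unitriangular families\<close>

text \<open>Describing the spaces by invariance removes structure constants from the proof: whether
  a product, a coproduct or an antipode stays in \<open>mSym\<close> becomes a question about
  renaming variables. The completed tensor square needs the same description, by invariance in each
  alphabet separately, so unitriangularity is stated for an arbitrary system \<open>E\<close> of
  equations between coefficients. Degree alone does not separate the lowest monomial, since a basis
  series may have many monomials of its lowest degree. The sum of the indices does: some filling is
  minimal box by box, and it alone attains the minimum. Symmetry is taken as invariance under
  injections and not just permutations. Then symmetric and quasisymmetric series can be treated
  alike, and a map can act on one alphabet while the other is moved out of its way. The recursion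
  for the antipode gives one of its two identities for every series. The other one rests on
  coassociativity and is therefore proved for invariant series only.\<close>

lemma lincombs_triangular:
  fixes u :: "'i \<Rightarrow> 'm series" and rank :: "'i \<Rightarrow> nat" and E :: "('m \<times> 'm) set"
  defines "X \<equiv> {f. \<forall>(m, m')\<in>E. f m = f m'}"
  assumes fin: "\<And>n. finite {i \<in> I. rank i \<le> n}"
    and tri: "\<And>i j. i \<in> I \<Longrightarrow> j \<in> I \<Longrightarrow> u i (rep j) \<noteq> 0 \<Longrightarrow> i = j \<or> rank i < rank j"
    and diag: "\<And>i. i \<in> I \<Longrightarrow> u i (rep i) = 1"
    and u: "\<And>i. i \<in> I \<Longrightarrow> u i \<in> X"
    and reps: "\<And>m. \<exists>i\<in>I. \<forall>f\<in>X. f m = f (rep i)"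
  shows "lincombs I u = X"
proof (intro equalityI subsetI)
  fix f assume "f \<in> lincombs I u"
  then obtain c where c: "((\<lambda>i. c i * u i m) has_sum f m) I" for m
    unfolding lincombs_def by auto
  have "f m = f m'" if "(m, m') \<in> E" for m m'
  proof -
    have "u i m = u i m'" if "i \<in> I" for i
      using u[OF that] \<open>(m, m') \<in> E\<close> unfolding X_def by auto
    then have "((\<lambda>i. c i * u i m) has_sum f m') I"
      using c[of m'] by (simp cong: has_sum_cong)
    with c[of m] show ?thesis by (rule has_sum_unique)
  qed
  then show "f \<in> X" unfolding X_def by auto
next
  fix f assume f: "f \<in> X"
  \<comment> \<open>The coefficients are solved for by recursion on \<open>rank\<close>: at
    \<open>rep j\<close> only \<open>u j\<close>, with coefficient 1, and members of smaller rank
    contribute.\<close>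
  define below where "below = (\<lambda>j. {i \<in> I. rank i < rank j})"
  define H where "H = (\<lambda>c j. f (rep j) - (\<Sum>i\<in>below j. c i * u i (rep j)))"
  define c where "c = wfrec (inv_image less_than rank) H"
  have c_eq: "c j = f (rep j) - (\<Sum>i\<in>below j. c i * u i (rep j))" for j
  proof -
    have "c j = H (cut c (inv_image less_than rank) j) j"
      unfolding c_def by (rule wfrec) auto
    also have "\<dots> = H c j"
      unfolding H_def by (auto simp: below_def cut_apply intro!: sum.cong)
    finally show ?thesis unfolding H_def .
  qed
  have fin_below: "finite (below j)" for j
    by (rule finite_subset[OF _ fin[of "rank j"]]) (auto simp: below_def)
  have "((\<lambda>i. c i * u i m) has_sum f m) I" for m
  proof -
    obtain j where j: "j \<in> I" and eq: "\<And>h. h \<in> X \<Longrightarrow> h m = h (rep j)"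
      using reps[of m] by blast
    have ueq: "u i m = u i (rep j)" if "i \<in> I" for i
      using eq u[OF that] by blast
    have nj: "j \<notin> below j" unfolding below_def by simp
    have "(\<Sum>i\<in>insert j (below j). c i * u i m) = (\<Sum>i\<in>insert j (below j). c i * u i (rep j))"
      by (intro sum.cong) (use j ueq in \<open>auto simp: below_def\<close>)
    also have "\<dots> = c j + (\<Sum>i\<in>below j. c i * u i (rep j))"
      using nj fin_below[of j] diag[OF j] by simp
    also have "\<dots> = f m"
      using c_eq[of j] eq[OF f] by simp
    finally have s: "f m = (\<Sum>i\<in>insert j (below j). c i * u i m)" ..
    show ?thesis
      by (rule has_sum_finite_neutralI[OF _ _ _ s])
        (use fin_below j tri[OF _ j] ueq in \<open>auto simp: below_def\<close>)
  qed
  then show "f \<in> lincombs I u" unfolding lincombs_def by blast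
qed

text \<open>
  Orders monomials by size and then by weight: the weight of the monomials used below is at most the
  square of their size, so the cube dominates it.
\<close>

definition size_weight_rank :: "nat multiset \<Rightarrow> nat" where
  "size_weight_rank m = size m ^ 3 + sum_mset m"

lemma singleton_filling:
  assumes "finite B" and T: "T \<in> B \<rightarrow>\<^sub>E {A :: nat set. finite A \<and> A \<noteq> {}}"
    and m: "(\<Sum>b\<in>B. mset_set (T b)) = m" and size: "size m \<le> card B"
  obtains t where "\<And>b. b \<in> B \<Longrightarrow> T b = {t b}"
proof -
  have pos: "1 \<le> card (T b)" if "b \<in> B" for b
    using PiE_mem[OF T that] by (simp add: Suc_leI card_gt_0_iff)
  have "size m = (\<Sum>b\<in>B. card (T b))"
    unfolding m[symmetric] by (simp add: size_multiset_sum)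
  then have "(\<Sum>b\<in>B. card (T b)) \<le> (\<Sum>b\<in>B. 1)"
    using size by simp
  then have "card (T b) = 1" if "b \<in> B" for b
    using sum_mono_inv[of "\<lambda>_. 1" B "\<lambda>b. card (T b)" b] sum_mono[of B "\<lambda>_. 1" "\<lambda>b. card (T b)"]
      pos that \<open>finite B\<close> by fastforce
  then have "\<forall>b\<in>B. \<exists>x. T b = {x}"
    by (simp add: card_1_singleton_iff)
  then show ?thesis using that by metis
qed

section \<open>Lowest terms of generating functions of fillings\<close>

context
  fixes B :: "'b set" and P :: "('b \<Rightarrow> nat set) \<Rightarrow> bool" and d :: "'b \<Rightarrow> nat"
  assumes finB: "finite B"
    and lower: "\<And>T b x. T \<in> B \<rightarrow>\<^sub>E {A. finite A \<and> A \<noteq> {}} \<Longrightarrow> P T \<Longrightarrow> b \<in> B \<Longrightarrow> x \<in> T b \<Longrightarrow> d b \<le> x"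
    and minimal: "P (\<lambda>b\<in>B. {d b})"
begin

text \<open>The bound on the size forces singletons. The weight is then a sum of entries, each at
  least \<open>d b\<close>, and the bound on the weight turns all these inequalities into
  equalities.\<close>

lemma lowest_filling_unique:
  assumes T: "T \<in> B \<rightarrow>\<^sub>E {A. finite A \<and> A \<noteq> {}}" and "P T"
    and m: "(\<Sum>b\<in>B. mset_set (T b)) = m"
    and size: "size m \<le> card B"
    and weight: "sum_mset m \<le> sum d B"
  shows "T = (\<lambda>b\<in>B. {d b})"
proof -
  obtain t where t: "\<And>b. b \<in> B \<Longrightarrow> T b = {t b}"
    using singleton_filling[OF finB T m size] by blast
  have "m = (\<Sum>b\<in>B. {#t b#})"
    unfolding m[symmetric] by (intro sum.cong) (auto simp: t)
  moreover have "sum_mset (\<Sum>b\<in>B. {#t b#}) = (\<Sum>b\<in>B. t b)"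
    using finB by induction auto
  ultimately have "sum_mset m = (\<Sum>b\<in>B. t b)" by simp
  moreover have le: "d b \<le> t b" if "b \<in> B" for b
    using lower[OF T \<open>P T\<close> that] t[OF that] by simp
  ultimately have "sum t B = sum d B"
    using weight sum_mono[of B d t] by simp
  then have "d b = t b" if "b \<in> B" for b
    using sum_mono_inv[of d B t b] le that finB by auto
  then show ?thesis
    using t T by (intro ext) (auto simp: PiE_def extensional_def)
qed

lemma lowest_filling_content:
  "(\<Sum>b\<in>B. mset_set ((\<lambda>b\<in>B. {d b}) b)) = image_mset d (mset_set B)"
proof -
  have "(\<Sum>b\<in>B. mset_set ((\<lambda>b\<in>B. {d b}) b)) = (\<Sum>b\<in>B. {#d b#})"
    by (intro sum.cong) auto
  also have "\<dots> = image_mset d (mset_set B)"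
    using finB by induction auto
  finally show ?thesis .
qed

lemma set_valued_series_lowest:
  "set_valued_series B P (image_mset d (mset_set B)) = 1"
proof -
  have "{T \<in> B \<rightarrow>\<^sub>E {A. finite A \<and> A \<noteq> {}}. P T \<and>
      (\<Sum>b\<in>B. mset_set (T b)) = image_mset d (mset_set B)} = {\<lambda>b\<in>B. {d b}}"
    (is "?X = _")
  proof (intro equalityI subsetI)
    fix T assume "T \<in> ?X"
    then show "T \<in> {\<lambda>b\<in>B. {d b}}"
      using lowest_filling_unique[of T] by (simp add: sum_unfold_sum_mset)
  next
    fix T assume "T \<in> {\<lambda>b\<in>B. {d b}}"
    then show "T \<in> ?X"
      using minimal lowest_filling_content by auto
  qed
  then show ?thesis unfolding set_valued_series_def by simp
qed

lemma set_valued_series_nonzero: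
  assumes "set_valued_series B P m \<noteq> 0"
  shows "m = image_mset d (mset_set B) \<or> card B < size m \<or> (card B = size m \<and> sum d B < sum_mset m)"
proof (rule ccontr)
  assume *: "\<not> ?thesis"
  have "card B \<le> size m"
    using assms set_valued_series_eq_0[OF finB, of m P] by linarith
  with * have m: "m \<noteq> image_mset d (mset_set B)" "size m \<le> card B" "sum_mset m \<le> sum d B"
    by auto
  have "{T \<in> B \<rightarrow>\<^sub>E {A. finite A \<and> A \<noteq> {}}. P T \<and> (\<Sum>b\<in>B. mset_set (T b)) = m} = {}"
  proof -
    have False if "T \<in> B \<rightarrow>\<^sub>E {A. finite A \<and> A \<noteq> {}}" "P T" "(\<Sum>b\<in>B. mset_set (T b)) = m" for T
      using lowest_filling_unique[OF that m(2,3)] lowest_filling_content that(3) m(1) by simp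
    then show ?thesis by auto
  qed
  then show False
    using assms unfolding set_valued_series_def by (metis card.empty of_nat_0)
qed

end

section \<open>Monomials attached to compositions\<close>

definition monomial :: "nat list \<Rightarrow> nat multiset" where
  "monomial \<alpha> = (\<Sum>i<length \<alpha>. replicate_mset (\<alpha> ! i) i)"

lemma count_monomial: "count (monomial \<alpha>) i = (if i < length \<alpha> then \<alpha> ! i else 0)"
  unfolding monomial_def count_sum by (simp add: sum.delta)

lemma set_monomial: "i \<in># monomial \<alpha> \<Longrightarrow> i < length \<alpha>"
  by (metis count_monomial not_in_iff)

lemma size_monomial: "size (monomial \<alpha>) = sum_list \<alpha>"
  unfolding monomial_def by (simp add: size_multiset_sum sum_list_sum_nth atLeast0LessThan)

lemma monomial_snoc: "monomial (\<alpha> @ [k]) = monomial \<alpha> + replicate_mset k (length \<alpha>)"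
  by (rule multiset_eqI) (auto simp: count_monomial nth_append)

lemma length_le_sum_list:
  "\<alpha> \<in> compositions \<Longrightarrow> length \<alpha> \<le> sum_list \<alpha>"
proof -
  have "\<forall>k\<in>set \<alpha>. k > 0 \<Longrightarrow> length \<alpha> \<le> sum_list \<alpha>"
    by (induction \<alpha>) auto
  then show "\<alpha> \<in> compositions \<Longrightarrow> length \<alpha> \<le> sum_list \<alpha>"
    by (simp add: compositions_def)
qed

text \<open>Positive parts make the support an initial segment, from which the length is recovered;
  lists differing by trailing zeros would collide.\<close>

lemma monomial_inj:
  assumes "\<alpha> \<in> compositions" "\<beta> \<in> compositions" "monomial \<alpha> = monomial \<beta>"
  shows "\<alpha> = \<beta>"
proof -
  have supp: "{i. count (monomial \<alpha>) i \<noteq> 0} = {..<length \<alpha>}" if "\<alpha> \<in> compositions" for \<alpha>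
  proof -
    have "0 < \<alpha> ! i" if "i < length \<alpha>" for i
      using \<open>\<alpha> \<in> compositions\<close> that nth_mem unfolding compositions_def by blast
    then show ?thesis by (auto simp: count_monomial)
  qed
  have "length \<alpha> = length \<beta>"
    using supp assms by (metis lessThan_eq_iff)
  moreover have "\<alpha> ! i = \<beta> ! i" if "i < length \<alpha>" for i
    using arg_cong[OF assms(3), of "\<lambda>m. count m i"] that \<open>length \<alpha> = length \<beta>\<close>
    by (simp add: count_monomial)
  ultimately show ?thesis by (rule nth_equalityI)
qed

lemma weight_monomial_le:
  assumes "\<alpha> \<in> compositions"
  shows "sum_mset (monomial \<alpha>) \<le> sum_list \<alpha> * sum_list \<alpha>"
proof -
  have "i \<le> sum_list \<alpha>" if "i \<in># monomial \<alpha>" for i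
    using set_monomial[OF that] length_le_sum_list[OF assms] by simp
  moreover have "sum_mset m \<le> size m * n" if "\<forall>i\<in>#m. i \<le> n" for m and n :: nat
    using that by (induction m) auto
  ultimately show ?thesis by (metis size_monomial)
qed

lemma rank_monomial_less:
  assumes "\<alpha> \<in> compositions"
    and "sum_list \<alpha> < size m \<or> (sum_list \<alpha> = size m \<and> sum_mset (monomial \<alpha>) < sum_mset m)"
  shows "size_weight_rank (monomial \<alpha>) < size_weight_rank m"
proof (cases "sum_list \<alpha> = size m")
  case True
  then show ?thesis using assms(2) by (simp add: size_weight_rank_def size_monomial)
next
  case False
  let ?n = "sum_list \<alpha>"
  \<comment> \<open>The weight is at most the square of the size, which is less than the gap between
    consecutive cubes.\<close>
  have "?n ^ 3 + ?n * ?n < (Suc ?n) ^ 3"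
    by (simp add: power3_eq_cube algebra_simps)
  also have "\<dots> \<le> size m ^ 3"
    using False assms(2) by (intro power_mono) auto
  finally show ?thesis
    using weight_monomial_le[OF assms(1)] by (simp add: size_weight_rank_def size_monomial)
qed

lemma finite_rank_le:
  assumes "I \<subseteq> compositions"
  shows "finite {\<alpha> \<in> I. size_weight_rank (monomial \<alpha>) \<le> n}"
proof (rule finite_subset[OF _ finite_compositions_le[of n]])
  have "sum_list \<alpha> \<le> n" if "size_weight_rank (monomial \<alpha>) \<le> n" for \<alpha>
  proof -
    have "sum_list \<alpha> \<le> sum_list \<alpha> ^ 3"
      by (cases "sum_list \<alpha>") (simp_all add: power3_eq_cube)
    then show ?thesis using that by (simp add: size_weight_rank_def size_monomial)
  qed
  then show "{\<alpha> \<in> I. size_weight_rank (monomial \<alpha>) \<le> n} \<subseteq> {\<alpha> \<in> compositions. sum_list \<alpha> \<le> n}"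
    using assms by auto
qed


section \<open>Symmetry of the series of set-valued tableaux\<close>

lemma finite_boxes: "finite (boxes \<mu>)"
  by (simp add: boxes_Sigma)

lemma boxes_antimono:
  assumes "\<mu> \<in> partitions" "(r', c') \<in> boxes \<mu>" "r \<le> r'" "c \<le> c'"
  shows "(r, c) \<in> boxes \<mu>"
proof -
  have "sorted_wrt (\<ge>) \<mu>" "r' < length \<mu>" "c' < \<mu> ! r'"
    using assms by (auto simp: partitions_def boxes_def)
  then have "\<mu> ! r' \<le> \<mu> ! r"
    using assms(3) by (cases "r = r'") (auto simp: sorted_wrt_iff_nth_less)
  then show ?thesis
    using \<open>r' < length \<mu>\<close> \<open>c' < \<mu> ! r'\<close> assms(3,4) by (auto simp: boxes_def)
qed

text \<open>Stated for single entries and for boxes at any distance, because the involution changes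
  individual entries and compares boxes that are far apart.\<close>

definition rows_weakly_increase :: "(nat \<times> nat) set \<Rightarrow> (nat \<times> nat \<Rightarrow> nat set) \<Rightarrow> bool" where
  "rows_weakly_increase B T \<longleftrightarrow> (\<forall>r c c'. (r, c) \<in> B \<longrightarrow> (r, c') \<in> B \<longrightarrow> c < c' \<longrightarrow>
     (\<forall>x\<in>T (r, c). \<forall>y\<in>T (r, c'). x \<le> y))"

definition columns_strictly_increase :: "(nat \<times> nat) set \<Rightarrow> (nat \<times> nat \<Rightarrow> nat set) \<Rightarrow> bool" where
  "columns_strictly_increase B T \<longleftrightarrow> (\<forall>r r' c. (r, c) \<in> B \<longrightarrow> (r', c) \<in> B \<longrightarrow> r < r' \<longrightarrow>
     (\<forall>x\<in>T (r, c). \<forall>y\<in>T (r', c). x < y))"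

text \<open>Adjacent comparisons are chained through an element of every box in between. These boxes
  exist because \<mu> is a partition, and their sets are nonempty.\<close>

lemma set_valued_tableau_iff:
  assumes \<mu>: "\<mu> \<in> partitions" and T: "T \<in> boxes \<mu> \<rightarrow>\<^sub>E {A. finite A \<and> A \<noteq> {}}"
  shows "set_valued_tableau \<mu> T \<longleftrightarrow>
    rows_weakly_increase (boxes \<mu>) T \<and> columns_strictly_increase (boxes \<mu>) T"
proof
  have fin: "finite (T b)" "T b \<noteq> {}" if "b \<in> boxes \<mu>" for b
    using PiE_mem[OF T that] by auto
  {
    assume tab: "set_valued_tableau \<mu> T"
    have row: "x \<le> y" if "(r, Suc c) \<in> boxes \<mu>" "x \<in> T (r, c)" "y \<in> T (r, Suc c)" for r c x y
    proof -
      have box: "(r, c) \<in> boxes \<mu>" by (rule boxes_antimono[OF \<mu> that(1)]) auto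
      then have "Max (T (r, c)) \<le> Min (T (r, Suc c))"
        using tab that(1) by (simp add: set_valued_tableau_def)
      then show ?thesis
        using fin[OF box] fin[OF that(1)] that by (meson Max_ge Min_le order_trans)
    qed
    have col: "x < y" if "(Suc r, c) \<in> boxes \<mu>" "x \<in> T (r, c)" "y \<in> T (Suc r, c)" for r c x y
    proof -
      have box: "(r, c) \<in> boxes \<mu>" by (rule boxes_antimono[OF \<mu> that(1)]) auto
      then have "Max (T (r, c)) < Min (T (Suc r, c))"
        using tab that(1) by (simp add: set_valued_tableau_def)
      then show ?thesis
        using fin[OF box] fin[OF that(1)] that by (meson Max_ge Min_le le_less_trans less_le_trans)
    qed
    have "x \<le> y" if "(r, c') \<in> boxes \<mu>" "c < c'" "x \<in> T (r, c)" "y \<in> T (r, c')" for r c c' x y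
      using that
    proof (induction c' arbitrary: y)
      case (Suc k)
      have box: "(r, k) \<in> boxes \<mu>" by (rule boxes_antimono[OF \<mu> Suc.prems(1)]) auto
      obtain z where z: "z \<in> T (r, k)" using fin(2)[OF box] by blast
      have "x \<le> z \<or> k = c" using Suc.IH[OF box _ _ z] Suc.prems by linarith
      then show ?case using row[OF Suc.prems(1) z Suc.prems(4)] row[OF Suc.prems(1) _ Suc.prems(4)]
          Suc.prems(3) by auto
    qed simp
    moreover have "x < y" if "(r', c) \<in> boxes \<mu>" "r < r'" "x \<in> T (r, c)" "y \<in> T (r', c)"
      for r r' c x y
      using that
    proof (induction r' arbitrary: y)
      case (Suc k)
      have box: "(k, c) \<in> boxes \<mu>" by (rule boxes_antimono[OF \<mu> Suc.prems(1)]) auto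
      obtain z where z: "z \<in> T (k, c)" using fin(2)[OF box] by blast
      have "x < z \<or> k = r" using Suc.IH[OF box _ _ z] Suc.prems by linarith
      then show ?case using col[OF Suc.prems(1) z Suc.prems(4)] col[OF Suc.prems(1) _ Suc.prems(4)]
          Suc.prems(3) by auto
    qed simp
    ultimately show "rows_weakly_increase (boxes \<mu>) T \<and> columns_strictly_increase (boxes \<mu>) T"
      unfolding rows_weakly_increase_def columns_strictly_increase_def by blast
  }
  assume rc: "rows_weakly_increase (boxes \<mu>) T \<and> columns_strictly_increase (boxes \<mu>) T"
  have "Max (T (i, j)) \<le> Min (T (i, j + 1))"
    if "(i, j) \<in> boxes \<mu>" "(i, j + 1) \<in> boxes \<mu>" for i j
  proof -
    have "Max (T (i, j)) \<in> T (i, j)" "Min (T (i, j + 1)) \<in> T (i, j + 1)"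
      using fin that by simp_all
    then show ?thesis using rc that unfolding rows_weakly_increase_def by (meson less_add_one)
  qed
  moreover have "Max (T (i, j)) < Min (T (i + 1, j))"
    if "(i, j) \<in> boxes \<mu>" "(i + 1, j) \<in> boxes \<mu>" for i j
  proof -
    have "Max (T (i, j)) \<in> T (i, j)" "Min (T (i + 1, j)) \<in> T (i + 1, j)"
      using fin that by simp_all
    then show ?thesis using rc that unfolding columns_strictly_increase_def by (meson less_add_one)
  qed
  ultimately show "set_valued_tableau \<mu> T"
    unfolding set_valued_tableau_def by blast
qed

text \<open>
  A Bender--Knuth involution exchanging \<open>a\<close> and \<open>a + 1\<close>. A box is free if it contains \<open>a\<close> or \<open>a + 1\<close>
  and no other box of its column does. The free boxes of a row are contiguous and contain \<open>a\<close> only, up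
  to some point, then at most one box contains both, and then come boxes with \<open>a + 1\<close> only; the
  involution reflects this pattern left to right while exchanging \<open>a\<close> and \<open>a + 1\<close>. Outside the free
  boxes \<open>a\<close> and \<open>a + 1\<close> come in vertical pairs.
\<close>

locale bender_knuth =
  fixes \<mu> :: "nat list" and a :: nat
  assumes partition: "\<mu> \<in> partitions"
begin

abbreviation "B \<equiv> boxes \<mu>"

definition tableaux :: "(nat \<times> nat \<Rightarrow> nat set) set" where
  "tableaux = {T \<in> B \<rightarrow>\<^sub>E {A. finite A \<and> A \<noteq> {}}. rows_weakly_increase B T \<and> columns_strictly_increase B T}"

definition occupied :: "(nat \<times> nat \<Rightarrow> nat set) \<Rightarrow> (nat \<times> nat) set" where
  "occupied T = {b \<in> B. a \<in> T b \<or> Suc a \<in> T b}"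

definition free :: "(nat \<times> nat \<Rightarrow> nat set) \<Rightarrow> (nat \<times> nat) set" where
  "free T = {(r, c). (r, c) \<in> occupied T \<and> (\<forall>r'. (r', c) \<in> occupied T \<longrightarrow> r' = r)}"

definition free_columns :: "(nat \<times> nat \<Rightarrow> nat set) \<Rightarrow> nat \<Rightarrow> nat set" where
  "free_columns T r = {c. (r, c) \<in> free T}"

text \<open>For a free column \<open>c\<close> the subtraction does not truncate, as
  \<open>c\<close> is at most the maximum.\<close>

definition mirror :: "(nat \<times> nat \<Rightarrow> nat set) \<Rightarrow> nat \<Rightarrow> nat \<Rightarrow> nat" where
  "mirror T r c = Min (free_columns T r) + Max (free_columns T r) - c"

definition swap :: "(nat \<times> nat \<Rightarrow> nat set) \<Rightarrow> (nat \<times> nat \<Rightarrow> nat set)" where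
  "swap T = (\<lambda>(r, c)\<in>B. if (r, c) \<in> free T
     then {x \<in> T (r, c). x \<noteq> a \<and> x \<noteq> Suc a} \<union>
       Transposition.transpose a (Suc a) ` (T (r, mirror T r c) \<inter> {a, Suc a})
     else T (r, c))"

lemma free_occupied: "b \<in> free T \<Longrightarrow> b \<in> occupied T"
  unfolding free_def by auto

lemma occupied_box: "b \<in> occupied T \<Longrightarrow> b \<in> B"
  unfolding occupied_def by auto

lemma finite_free_columns: "finite (free_columns T r)"
proof (rule finite_subset)
  show "free_columns T r \<subseteq> snd ` B"
    unfolding free_columns_def free_def occupied_def by force
qed (simp add: boxes_Sigma)

lemma box_above: "(r', c) \<in> B \<Longrightarrow> r \<le> r' \<Longrightarrow> (r, c) \<in> B"
  using boxes_antimono[OF partition] by blast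

lemma box_left: "(r, c') \<in> B \<Longrightarrow> c \<le> c' \<Longrightarrow> (r, c) \<in> B"
  using boxes_antimono[OF partition] by blast

context
  fixes T assumes T: "T \<in> tableaux"
begin

lemma nonempty: "b \<in> B \<Longrightarrow> \<exists>x. x \<in> T b"
  using T unfolding tableaux_def by (auto dest!: PiE_mem)

lemma row: "(r, c) \<in> B \<Longrightarrow> (r, c') \<in> B \<Longrightarrow> c < c' \<Longrightarrow> x \<in> T (r, c) \<Longrightarrow> y \<in> T (r, c') \<Longrightarrow> x \<le> y"
  using T unfolding tableaux_def rows_weakly_increase_def by blast

lemma col: "(r, c) \<in> B \<Longrightarrow> (r', c) \<in> B \<Longrightarrow> r < r' \<Longrightarrow> x \<in> T (r, c) \<Longrightarrow> y \<in> T (r', c) \<Longrightarrow> x < y"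
  using T unfolding tableaux_def columns_strictly_increase_def by blast

lemma occupied_cases:
  assumes "b \<in> occupied T" obtains x where "x \<in> T b" "x = a \<or> x = Suc a"
  using assms unfolding occupied_def by auto

text \<open>
  A column with two occupied boxes has \<open>a\<close> in one box and \<open>a + 1\<close> in a box below it. Then so has
  every column further left whose upper box is occupied, and every column further right whose lower
  box is occupied.
\<close>

lemma left_of_nonfree:
  assumes "(r, c') \<in> occupied T" "a \<in> T (r, c')" "(r, c') \<notin> free T" "c < c'" "(r, c) \<in> occupied T"
  shows "(r, c) \<notin> free T"
proof -
  have rc': "(r, c') \<in> B" and rc: "(r, c) \<in> B" using assms occupied_box by auto
  obtain r' where r': "r' \<noteq> r" "(r', c') \<in> occupied T"
    using assms(1,3) unfolding free_def by auto
  obtain z where z: "z \<in> T (r', c')" "z = a \<or> z = Suc a" using r'(2) occupied_cases by blast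
  have b': "(r', c') \<in> B" using r' occupied_box by auto
  \<comment> \<open>If row \<open>r'\<close> were above row \<open>r\<close>, then \<open>z\<close>
    would be less than \<open>a\<close>.\<close>
  have "r < r'"
    using col[OF b' rc' _ z(1) assms(2)] z(2) r'(1) by force
  \<comment> \<open>The entries of this box are squeezed: greater than \<open>v\<close>, which is at
    least \<open>a\<close>, and at most \<open>z\<close>, which is at most \<open>Suc a\<close>. So
    they equal \<open>Suc a\<close>, and the box is a second occupied one in column
    \<open>c\<close>.\<close>
  have bx: "(r', c) \<in> B" using box_left[OF b'] assms(4) by simp
  obtain w where w: "w \<in> T (r', c)" using nonempty[OF bx] by blast
  have "w \<le> Suc a" using row[OF bx b' assms(4) w z(1)] z(2) by auto
  obtain v where v: "v \<in> T (r, c)" "v = a \<or> v = Suc a" using assms(5) occupied_cases by blast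
  have "v < w" using col[OF rc bx \<open>r < r'\<close> v(1) w] .
  then have "w = Suc a" using \<open>w \<le> Suc a\<close> v(2) by auto
  then have "(r', c) \<in> occupied T" using w bx unfolding occupied_def by auto
  then show ?thesis using r'(1) unfolding free_def by auto
qed

lemma right_of_nonfree:
  assumes "(r, c) \<in> occupied T" "Suc a \<in> T (r, c)" "(r, c) \<notin> free T" "c < c'" "(r, c') \<in> occupied T"
  shows "(r, c') \<notin> free T"
proof -
  have rc': "(r, c') \<in> B" and rc: "(r, c) \<in> B" using assms occupied_box by auto
  obtain r' where r': "r' \<noteq> r" "(r', c) \<in> occupied T"
    using assms(1,3) unfolding free_def by auto
  obtain z where z: "z \<in> T (r', c)" "z = a \<or> z = Suc a" using r'(2) occupied_cases by blast
  have b': "(r', c) \<in> B" using r' occupied_box by auto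
  have "r' < r"
    using col[OF rc b' _ assms(2) z(1)] z(2) r'(1) by force
  \<comment> \<open>The same squeeze with roles exchanged: the entries are at least
    \<open>z\<close>, hence at least \<open>a\<close>, and less than \<open>v\<close>, hence less
    than \<open>Suc a\<close>.\<close>
  have bx: "(r', c') \<in> B" using box_above[OF rc'] \<open>r' < r\<close> by simp
  obtain w where w: "w \<in> T (r', c')" using nonempty[OF bx] by blast
  have "a \<le> w" using row[OF b' bx assms(4) z(1) w] z(2) by auto
  obtain v where v: "v \<in> T (r, c')" "v = a \<or> v = Suc a" using assms(5) occupied_cases by blast
  have "w < v" using col[OF bx rc' \<open>r' < r\<close> w v(1)] .
  then have "w = a" using \<open>a \<le> w\<close> v(2) by auto
  then have "(r', c') \<in> occupied T" using w bx unfolding occupied_def by auto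
  then show ?thesis using r'(1) unfolding free_def by auto
qed

text \<open>The entries of the middle box lie between values from {a, a+1}, so it is occupied. If it
  were not free, an entry \<open>a\<close> would make the left end nonfree, and an entry
  \<open>Suc a\<close> the right end.\<close>

lemma free_interval:
  assumes "(r, c1) \<in> free T" "(r, c2) \<in> free T" "c1 \<le> c" "c \<le> c2"
  shows "(r, c) \<in> free T"
proof (cases "c = c1 \<or> c = c2")
  case False
  then have less: "c1 < c" "c < c2" using assms by auto
  have occ: "(r, c1) \<in> occupied T" "(r, c2) \<in> occupied T" using assms free_occupied by auto
  then have box: "(r, c1) \<in> B" "(r, c2) \<in> B" using occupied_box by auto
  have rc: "(r, c) \<in> B" using box_left[OF box(2)] less by simp
  obtain x where x: "x \<in> T (r, c)" using nonempty[OF rc] by blast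
  obtain v where v: "v \<in> T (r, c1)" "v = a \<or> v = Suc a" using occ occupied_cases by blast
  obtain w where w: "w \<in> T (r, c2)" "w = a \<or> w = Suc a" using occ occupied_cases by blast
  have "v \<le> x" "x \<le> w"
    using row[OF box(1) rc less(1) v(1) x] row[OF rc box(2) less(2) x w(1)] by auto
  then have xa: "x = a \<or> x = Suc a" using v(2) w(2) by auto
  then have "(r, c) \<in> occupied T" using x rc unfolding occupied_def by auto
  then show ?thesis
    using left_of_nonfree[OF _ _ _ less(1) occ(1)] right_of_nonfree[OF _ _ _ less(2) occ(2)]
      assms(1,2) x xa by blast
qed (use assms in auto)

lemma mirror:
  assumes "(r, c) \<in> free T"
  shows "(r, mirror T r c) \<in> free T" and "mirror T r (mirror T r c) = c"
    and "(r, c') \<in> free T \<Longrightarrow> c < c' \<Longrightarrow> mirror T r c' < mirror T r c"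
proof -
  let ?Z = "free_columns T r"
  have in_Z: "c' \<in> ?Z \<Longrightarrow> Min ?Z \<le> c' \<and> c' \<le> Max ?Z" for c'
    using finite_free_columns by simp
  have c: "c \<in> ?Z" using assms by (simp add: free_columns_def)
  then have "Min ?Z \<in> ?Z" "Max ?Z \<in> ?Z"
    using finite_free_columns Min_in Max_in by blast+
  then have "(r, Min ?Z) \<in> free T" "(r, Max ?Z) \<in> free T"
    unfolding free_columns_def by auto
  then show "(r, mirror T r c) \<in> free T"
    by (rule free_interval) (use in_Z[OF c] in \<open>auto simp: mirror_def\<close>)
  show "mirror T r (mirror T r c) = c"
    using in_Z[OF c] by (auto simp: mirror_def)
  show "mirror T r c' < mirror T r c" if "(r, c') \<in> free T" "c < c'"
  proof -
    have "c' \<in> ?Z" using that(1) by (simp add: free_columns_def)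
    then show ?thesis using in_Z[OF c] in_Z[of c'] that(2) by (auto simp: mirror_def)
  qed
qed

lemma swap_other: "b \<in> B \<Longrightarrow> x \<noteq> a \<Longrightarrow> x \<noteq> Suc a \<Longrightarrow> x \<in> swap T b \<longleftrightarrow> x \<in> T b"
  unfolding swap_def by (cases b) (auto simp: Transposition.transpose_def split: if_splits)

lemma swap_nonfree: "b \<in> B \<Longrightarrow> b \<notin> free T \<Longrightarrow> swap T b = T b"
  unfolding swap_def by auto

lemma swap_free:
  assumes "(r, c) \<in> free T"
  shows "a \<in> swap T (r, c) \<longleftrightarrow> Suc a \<in> T (r, mirror T r c)"
    and "Suc a \<in> swap T (r, c) \<longleftrightarrow> a \<in> T (r, mirror T r c)"
proof -
  have "(r, c) \<in> B" using assms free_occupied occupied_box by blast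
  then show "a \<in> swap T (r, c) \<longleftrightarrow> Suc a \<in> T (r, mirror T r c)"
    and "Suc a \<in> swap T (r, c) \<longleftrightarrow> a \<in> T (r, mirror T r c)"
    unfolding swap_def using assms by (auto simp: Transposition.transpose_def intro!: rev_image_eqI)
qed

text \<open>A free box takes its new entries from a free box, hence from an occupied one, and so
  stays occupied. Consequently \<open>swap T\<close> has the same free boxes and the same reflection
  as \<open>T\<close>, which is what makes \<open>swap\<close> an involution.\<close>

lemma occupied_swap: "occupied (swap T) = occupied T"
proof -
  have "a \<in> swap T b \<or> Suc a \<in> swap T b \<longleftrightarrow> a \<in> T b \<or> Suc a \<in> T b" if "b \<in> B" for b
  proof (cases "b \<in> free T")
    case True
    obtain r c where b: "b = (r, c)" by (cases b)
    have "b \<in> occupied T" "(r, mirror T r c) \<in> occupied T"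
      using True mirror(1)[of r c] free_occupied b by auto
    then show ?thesis using swap_free[of r c] True b unfolding occupied_def by auto
  qed (simp add: swap_nonfree that)
  then show ?thesis unfolding occupied_def by blast
qed

lemma free_swap: "free (swap T) = free T"
  unfolding free_def occupied_swap ..

lemma mirror_swap: "mirror (swap T) = mirror T"
  unfolding mirror_def free_columns_def free_swap ..

text \<open>A number other than \<open>a\<close> and \<open>Suc a\<close> compares in the same way
  with both of them. Its order relation to a swapped entry can thus be read off from an old entry
  \<open>z\<close> of the same box.\<close>

lemma swap_in_occupied:
  assumes "b \<in> B" "x \<in> swap T b" "x = a \<or> x = Suc a"
  obtains z where "z \<in> T b" "z = a \<or> z = Suc a" "b \<in> occupied T"
proof -
  have "b \<in> occupied (swap T)" using assms unfolding occupied_def by auto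
  then have "b \<in> occupied T" unfolding occupied_swap .
  then show ?thesis using that occupied_cases by blast
qed

text \<open>Only \<open>Suc a\<close> to the left of \<open>a\<close> could go wrong. If both boxes
  are free, reflection turns this into the same violation in \<open>T\<close>; if neither is, it was
  already in \<open>T\<close>; if exactly one is, \<open>left_of_nonfree\<close> or
  \<open>right_of_nonfree\<close> excludes it.\<close>

lemma swap_row:
  assumes box: "(r, c) \<in> B" "(r, c') \<in> B" and less: "c < c'"
    and x: "x \<in> swap T (r, c)" and y: "y \<in> swap T (r, c')"
  shows "x \<le> y"
proof (cases "x = a \<or> x = Suc a")
  case False
  then have xT: "x \<in> T (r, c)" using swap_other[OF box(1)] x by blast
  show ?thesis
  proof (cases "y = a \<or> y = Suc a")
    case False
    then show ?thesis using swap_other[OF box(2)] y row[OF box less xT] by blast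
  next
    case True
    obtain z where "z \<in> T (r, c')" "z = a \<or> z = Suc a"
      using swap_in_occupied[OF box(2) y True] by blast
    then show ?thesis using row[OF box less xT, of z] True \<open>\<not> (x = a \<or> x = Suc a)\<close> by linarith
  qed
next
  case True
  obtain z where z: "z \<in> T (r, c)" "z = a \<or> z = Suc a" and occ: "(r, c) \<in> occupied T"
    using swap_in_occupied[OF box(1) x True] by blast
  show ?thesis
  proof (cases "y = a \<or> y = Suc a")
    case False
    then have "y \<in> T (r, c')" using swap_other[OF box(2)] y by blast
    then show ?thesis using row[OF box less z(1), of y] True False z(2) by linarith
  next
    case y': True
    have occ': "(r, c') \<in> occupied T"
      using swap_in_occupied[OF box(2) y y'] by blast
    show ?thesis
    proof (rule ccontr)
      assume "\<not> x \<le> y"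
      with True y' have xy: "x = Suc a" "y = a" by auto
      show False
      proof (cases "(r, c) \<in> free T")
        case free: True
        show False
        proof (cases "(r, c') \<in> free T")
          case free': True
          have "Suc a \<in> T (r, mirror T r c')" "a \<in> T (r, mirror T r c)"
            using swap_free free free' x y xy by auto
          moreover have "(r, mirror T r c') \<in> B" "(r, mirror T r c) \<in> B"
            using mirror(1) free free' free_occupied occupied_box by blast+
          ultimately show False
            using row mirror(3)[OF free free' less] by fastforce
        next
          case False
          then have "a \<in> T (r, c')" using swap_nonfree box y xy by auto
          then show False using left_of_nonfree[OF occ' _ False less occ] free by blast
        qed
      next
        case False
        then have sa: "Suc a \<in> T (r, c)" using swap_nonfree box x xy by auto
        show False
        proof (cases "(r, c') \<in> free T")
          case True
          then show False using right_of_nonfree[OF occ sa False less occ'] by blast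
        next
          case False
          then have "a \<in> T (r, c')" using swap_nonfree box y xy by auto
          then show False using row[OF box less sa] by fastforce
        qed
      qed
    qed
  qed
qed

text \<open>Two occupied boxes of one column are both nonfree, so the swap leaves them
  alone.\<close>

lemma swap_col:
  assumes box: "(r, c) \<in> B" "(r', c) \<in> B" and less: "r < r'"
    and x: "x \<in> swap T (r, c)" and y: "y \<in> swap T (r', c)"
  shows "x < y"
proof (cases "x = a \<or> x = Suc a")
  case False
  then have xT: "x \<in> T (r, c)" using swap_other[OF box(1)] x by blast
  show ?thesis
  proof (cases "y = a \<or> y = Suc a")
    case False
    then show ?thesis using swap_other[OF box(2)] y col[OF box less xT] by blast
  next
    case True
    obtain z where "z \<in> T (r', c)" "z = a \<or> z = Suc a"
      using swap_in_occupied[OF box(2) y True] by blast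
    then show ?thesis using col[OF box less xT, of z] True \<open>\<not> (x = a \<or> x = Suc a)\<close> by linarith
  qed
next
  case True
  obtain z where z: "z \<in> T (r, c)" "z = a \<or> z = Suc a" and occ: "(r, c) \<in> occupied T"
    using swap_in_occupied[OF box(1) x True] by blast
  show ?thesis
  proof (cases "y = a \<or> y = Suc a")
    case False
    then have "y \<in> T (r', c)" using swap_other[OF box(2)] y by blast
    then show ?thesis using col[OF box less z(1), of y] True False z(2) by linarith
  next
    case y': True
    have occ': "(r', c) \<in> occupied T"
      using swap_in_occupied[OF box(2) y y'] by blast
    then have "(r, c) \<notin> free T" "(r', c) \<notin> free T"
      using occ less unfolding free_def by auto
    then show ?thesis using swap_nonfree box x y col[OF box less] by auto
  qed
qed

lemma swap_tableau: "swap T \<in> tableaux"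
proof -
  have TP: "T \<in> B \<rightarrow>\<^sub>E {A. finite A \<and> A \<noteq> {}}"
    using T by (simp add: tableaux_def)
  have fin: "finite (swap T b) \<and> swap T b \<noteq> {}" if b: "b \<in> B" for b
  proof (cases "b \<in> free T")
    case True
    have "b \<in> occupied (swap T)" using True free_occupied occupied_swap by auto
    then have "swap T b \<noteq> {}" unfolding occupied_def by auto
    moreover have "finite (T b)" using PiE_mem[OF TP b] by simp
    then have "finite (swap T b)"
      by (rule_tac finite_subset[of _ "T b \<union> {a, Suc a}"]) (use swap_other[OF b] in auto)
    ultimately show ?thesis by blast
  next
    case False
    then show ?thesis using PiE_mem[OF TP b] swap_nonfree[OF b] by simp
  qed
  have "swap T \<in> B \<rightarrow>\<^sub>E {A. finite A \<and> A \<noteq> {}}"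
    by (rule PiE_I) (use fin in \<open>auto simp: swap_def\<close>)
  then show ?thesis
    unfolding tableaux_def rows_weakly_increase_def columns_strictly_increase_def
    using swap_row swap_col by blast
qed

end

lemma swap_swap:
  assumes T: "T \<in> tableaux"
  shows "swap (swap T) = T"
proof (rule PiE_ext[of _ B "\<lambda>_. UNIV"])
  show "swap (swap T) \<in> B \<rightarrow>\<^sub>E UNIV" "T \<in> B \<rightarrow>\<^sub>E UNIV"
    using swap_tableau[OF swap_tableau[OF T]] T by (auto simp: tableaux_def)
  fix b assume b: "b \<in> B"
  obtain r c where rc: "b = (r, c)" by (cases b)
  note T' = swap_tableau[OF T]
  show "swap (swap T) b = T b"
  proof (cases "b \<in> free T")
    case True
    then have free: "(r, c) \<in> free T" "(r, c) \<in> free (swap T)"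
      using rc free_swap[OF T] by auto
    have "x \<in> swap (swap T) b \<longleftrightarrow> x \<in> T b" for x
    proof (cases "x = a \<or> x = Suc a")
      case True
      then show ?thesis
        unfolding rc
        using swap_free[OF T' free(2)] swap_free[OF T mirror(1)[OF T free(1)]] mirror(2)[OF T free(1)]
        by (auto simp: mirror_swap[OF T])
    next
      case False
      then show ?thesis using swap_other[OF T' b] swap_other[OF T b] by auto
    qed
    then show ?thesis by blast
  next
    case False
    then show ?thesis
      using swap_nonfree[OF T b] swap_nonfree[OF T' b] free_swap[OF T] by simp
  qed
qed

lemma card_swap_free:
  assumes T: "T \<in> tableaux"
  shows "card {b \<in> free T. a \<in> swap T b} = card {b \<in> free T. Suc a \<in> T b}"
proof (rule bij_betw_same_card)
  let ?f = "\<lambda>(r, c). (r, mirror T r c)"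
  show "bij_betw ?f {b \<in> free T. a \<in> swap T b} {b \<in> free T. Suc a \<in> T b}"
    by (rule bij_betw_byWitness[where f' = ?f])
      (use mirror[OF T] swap_free[OF T] in auto)
qed

text \<open>Strict columns contain each value at most once, so boxes can be counted by their
  columns. In a nonfree box, either value forces the other one in a second box of the same column,
  again nonfree.\<close>

lemma card_nonfree:
  assumes T: "T \<in> tableaux"
  shows "card {b \<in> B - free T. a \<in> T b} = card {b \<in> B - free T. Suc a \<in> T b}" (is "card ?L = card ?R")
proof -
  have inj: "inj_on snd {b \<in> B - free T. k \<in> T b}" for k
  proof (rule inj_onI, clarify)
    fix r c r' c' assume *: "(r, c) \<in> B" "k \<in> T (r, c)" "(r', c') \<in> B" "k \<in> T (r', c')"
      "snd (r, c) = snd (r', c')"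
    then show "r = r' \<and> c = c'"
      using col[OF T, of r c r' k k] col[OF T, of r' c r k k] by (cases r r' rule: linorder_cases) auto
  qed
  have "snd ` ?L = snd ` ?R"
  proof (intro equalityI subsetI)
    fix c assume "c \<in> snd ` ?L"
    then obtain r where r: "(r, c) \<in> B" "(r, c) \<notin> free T" "a \<in> T (r, c)" by auto
    then have o: "(r, c) \<in> occupied T" by (simp add: occupied_def)
    then obtain r' where r': "(r', c) \<in> occupied T" "r' \<noteq> r"
      using r(2) unfolding free_def by auto
    then have nf: "(r', c) \<notin> free T" and b': "(r', c) \<in> B"
      using o occupied_box unfolding free_def by auto
    obtain z where z: "z \<in> T (r', c)" "z = a \<or> z = Suc a" using r'(1) occupied_cases[OF T] by blast
    have "z = Suc a"
      using z(2) col[OF T r(1) b' _ r(3) z(1)] col[OF T b' r(1) _ z(1) r(3)] r'(2) by force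
    then show "c \<in> snd ` ?R" using z(1) nf b' by force
  next
    fix c assume "c \<in> snd ` ?R"
    then obtain r where r: "(r, c) \<in> B" "(r, c) \<notin> free T" "Suc a \<in> T (r, c)" by auto
    then have o: "(r, c) \<in> occupied T" by (simp add: occupied_def)
    then obtain r' where r': "(r', c) \<in> occupied T" "r' \<noteq> r"
      using r(2) unfolding free_def by auto
    then have nf: "(r', c) \<notin> free T" and b': "(r', c) \<in> B"
      using o occupied_box unfolding free_def by auto
    obtain z where z: "z \<in> T (r', c)" "z = a \<or> z = Suc a" using r'(1) occupied_cases[OF T] by blast
    have "z = a"
      using z(2) col[OF T r(1) b' _ r(3) z(1)] col[OF T b' r(1) _ z(1) r(3)] r'(2) by force
    then show "c \<in> snd ` ?L" using z(1) nf b' by force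
  qed
  then show ?thesis
    using card_image[OF inj[of a]] card_image[OF inj[of "Suc a"]] by simp
qed

lemma card_swap:
  assumes T: "T \<in> tableaux"
  shows "card {b \<in> B. a \<in> swap T b} = card {b \<in> B. Suc a \<in> T b}"
proof -
  have split: "card {b \<in> B. Q b} = card {b \<in> free T. Q b} + card {b \<in> B - free T. Q b}" for Q
  proof -
    have "free T \<subseteq> B" using free_occupied occupied_box by blast
    then have "{b \<in> B. Q b} = {b \<in> free T. Q b} \<union> {b \<in> B - free T. Q b}"
      and "finite (free T)"
      using finite_boxes finite_subset by auto
    then show ?thesis
      using finite_boxes by (simp only:) (subst card_Un_disjoint, auto)
  qed
  have "{b \<in> B - free T. a \<in> swap T b} = {b \<in> B - free T. a \<in> T b}"
    using swap_nonfree[OF T] by auto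
  then show ?thesis
    using card_swap_free[OF T] card_nonfree[OF T]
      split[of "\<lambda>b. a \<in> swap T b"] split[of "\<lambda>b. Suc a \<in> T b"] by simp
qed

lemma swap_content:
  assumes T: "T \<in> tableaux"
  shows "(\<Sum>b\<in>B. mset_set (swap T b)) =
    image_mset (Transposition.transpose a (Suc a)) (\<Sum>b\<in>B. mset_set (T b))"
proof (rule multiset_eqI)
  fix k
  let ?t = "Transposition.transpose a (Suc a)"
  have count: "count (\<Sum>b\<in>B. mset_set (U b)) k = card {b \<in> B. k \<in> U b}" if "U \<in> tableaux" for U k
  proof -
    have "finite (U b)" if "b \<in> B" for b
      using \<open>U \<in> tableaux\<close> that unfolding tableaux_def by (auto dest!: PiE_mem)
    then have "count (\<Sum>b\<in>B. mset_set (U b)) k = (\<Sum>b\<in>B. if k \<in> U b then 1 else 0)"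
      unfolding count_sum by (intro sum.cong) (auto simp: count_mset_set')
    then show ?thesis using finite_boxes by (simp add: sum.If_cases Int_def)
  qed
  have "card {b \<in> B. k \<in> swap T b} = card {b \<in> B. ?t k \<in> T b}"
  proof (cases "k = a \<or> k = Suc a")
    case True
    \<comment> \<open>For \<open>k = Suc a\<close> the count comes from \<open>card_swap\<close>
      applied to \<open>swap T\<close>, whose swap is \<open>T\<close>.\<close>
    then show ?thesis
      using card_swap[OF T] card_swap[OF swap_tableau[OF T]] swap_swap[OF T] by auto
  next
    case False
    then show ?thesis using swap_other[OF T] by (auto intro: arg_cong[where f = card])
  qed
  moreover have "count (image_mset ?t M) k = count M (?t k)" for M
  proof -
    have "k = ?t y \<longleftrightarrow> ?t k = y" for y
      by (metis transpose_involutory)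
    then show ?thesis by (induction M) auto
  qed
  ultimately show "count (\<Sum>b\<in>B. mset_set (swap T b)) k =
      count (image_mset ?t (\<Sum>b\<in>B. mset_set (T b))) k"
    using count[OF T] count[OF swap_tableau[OF T]] by simp
qed

lemma Ktilde_adjacent_transpose:
  "Ktilde \<mu> (image_mset (Transposition.transpose a (Suc a)) m) = Ktilde \<mu> m"
proof -
  let ?t = "Transposition.transpose a (Suc a)"
  define X where "X = (\<lambda>m. {T \<in> tableaux. (\<Sum>b\<in>B. mset_set (T b)) = m})"
  have K: "Ktilde \<mu> m = int (card (X m))" for m
    unfolding Ktilde_def set_valued_series_def X_def tableaux_def
    using set_valued_tableau_iff[OF partition]
    by (intro arg_cong[where f = "\<lambda>A. int (card A)"]) auto
  have tt: "image_mset ?t (image_mset ?t m) = m"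
    by (simp add: multiset.map_comp)
  have "bij_betw swap (X m) (X (image_mset ?t m))"
    by (rule bij_betw_byWitness[where f' = swap])
      (auto simp: X_def swap_swap swap_content swap_tableau tt)
  then show ?thesis unfolding K by (simp add: bij_betw_same_card)
qed

end

section \<open>From adjacent transpositions to injective maps of the variables\<close>

lemma invariant_transpose:
  fixes f :: "nat multiset \<Rightarrow> 'a"
  assumes adj: "\<And>a m. f (image_mset (Transposition.transpose a (Suc a)) m) = f m"
  shows "f (image_mset (Transposition.transpose a b) m) = f m"
proof -
  have step: "f (image_mset (Transposition.transpose a (Suc (a + k))) m) = f m" for a k m
  proof (induction k arbitrary: m)
    case (Suc k)
    let ?s = "Transposition.transpose (Suc (a + k)) (Suc (a + Suc k))"
    let ?t = "Transposition.transpose a (Suc (a + k))"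
    \<comment> \<open>Conjugation by an adjacent transposition lengthens the distance by
      one.\<close>
    have "Transposition.transpose a (Suc (a + Suc k)) = ?s \<circ> (?t \<circ> ?s)"
      by (auto simp: fun_eq_iff Transposition.transpose_def)
    then have "f (image_mset (Transposition.transpose a (Suc (a + Suc k))) m) =
        f (image_mset ?s (image_mset ?t (image_mset ?s m)))"
      by (simp add: multiset.map_comp)
    also have "\<dots> = f (image_mset ?t (image_mset ?s m))"
      using adj[of "Suc (a + k)"] by simp
    also have "\<dots> = f m"
      using Suc adj[of "Suc (a + k)" m] by simp
    finally show ?case .
  qed (simp add: adj)
  show ?thesis
  proof (cases a b rule: linorder_cases)
    case less
    then obtain k where "b = Suc (a + k)" using less_imp_Suc_add by blast
    then show ?thesis using step by simp
  next
    case greater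
    then obtain k where "a = Suc (b + k)" using less_imp_Suc_add by blast
    then show ?thesis using step[of b k m] by (simp add: transpose_commute)
  qed simp
qed

text \<open>On a fixed monomial an injection acts like a finite product of transpositions, even if
  it is not surjective. Exchanging \<open>x\<close> with \<open>g x\<close> and then applying
  \<open>g\<close> composed with this exchange has the effect of \<open>g\<close>. The composite
  fixes \<open>g x\<close>, which has replaced \<open>x\<close>, and by injectivity it still fixes
  the variables of \<open>m\<close> that \<open>g\<close> fixed, so fewer variables move.\<close>

lemma invariant_inj:
  fixes f :: "'b multiset \<Rightarrow> 'a"
  assumes f: "\<And>a b m. f (image_mset (Transposition.transpose a b) m) = f m" and "inj g"
  shows "f (image_mset g m) = f m"
  using \<open>inj g\<close>
proof (induction "card {x \<in> set_mset m. g x \<noteq> x}" arbitrary: g m rule: less_induct)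
  case less
  show ?case
  proof (cases "\<forall>x\<in>#m. g x = x")
    case True
    then show ?thesis by (metis image_mset_cong multiset.map_ident)
  next
    case False
    then obtain x where x: "x \<in># m" "g x \<noteq> x" by blast
    let ?t = "Transposition.transpose x (g x)"
    have "{y \<in> set_mset (image_mset ?t m). (g \<circ> ?t) y \<noteq> y} \<subseteq>
        ?t ` ({y \<in> set_mset m. g y \<noteq> y} - {x})"
    proof
      fix y assume "y \<in> {y \<in> set_mset (image_mset ?t m). (g \<circ> ?t) y \<noteq> y}"
      then obtain z where z: "z \<in># m" "y = ?t z" "g z \<noteq> y" by auto
      have "z \<noteq> x" using z by auto
      moreover have "g z \<noteq> z"
        using z x \<open>inj g\<close> \<open>z \<noteq> x\<close> by (auto simp: Transposition.transpose_def dest: injD split: if_splits)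
      ultimately show "y \<in> ?t ` ({y \<in> set_mset m. g y \<noteq> y} - {x})"
        using z by auto
    qed
    then have "card {y \<in> set_mset (image_mset ?t m). (g \<circ> ?t) y \<noteq> y} \<le>
        card ({y \<in> set_mset m. g y \<noteq> y} - {x})"
      by (rule surj_card_le[rotated]) simp
    also have "\<dots> < card {y \<in> set_mset m. g y \<noteq> y}"
      by (rule card_Diff1_less) (use x in auto)
    finally have "f (image_mset (g \<circ> ?t) (image_mset ?t m)) = f (image_mset ?t m)"
      by (rule less.hyps) (intro inj_compose \<open>inj g\<close> inj_on_inverseI[of _ ?t], simp)
    moreover have "image_mset (g \<circ> ?t) (image_mset ?t m) = image_mset g m"
      by (simp add: multiset.map_comp comp_assoc)
    ultimately show ?thesis using f by simp
  qed
qed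

lemma Ktilde_image:
  assumes "\<mu> \<in> partitions" "inj g"
  shows "Ktilde \<mu> (image_mset g m) = Ktilde \<mu> m"
proof (rule invariant_inj[OF _ assms(2)])
  show "Ktilde \<mu> (image_mset (Transposition.transpose a b) m) = Ktilde \<mu> m" for a b m
    by (rule invariant_transpose)
      (use assms(1) bender_knuth.Ktilde_adjacent_transpose bender_knuth.intro in blast)
qed


section \<open>The spaces of quasisymmetric and symmetric series\<close>

definition invariants :: "(nat \<Rightarrow> nat) set \<Rightarrow> xseries set" where
  "invariants G = {f. \<forall>g\<in>G. \<forall>m. f (image_mset g m) = f m}"

definition invariants2 :: "(nat \<Rightarrow> nat) set \<Rightarrow> xyseries set" where
  "invariants2 G = {F. \<forall>g\<in>G. \<forall>a b. F (image_mset g a, b) = F (a, b) \<and> F (a, image_mset g b) = F (a, b)}"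

lemma strict_mono_inj: "strict_mono (g :: nat \<Rightarrow> nat) \<Longrightarrow> inj g"
  by (simp add: strict_mono_imp_inj_on)

abbreviation "quasisymmetric \<equiv> invariants {g. strict_mono g}"
abbreviation "symmetric \<equiv> invariants {g. inj g}"

text \<open>
  Closure under \<open>act_high\<close> and \<open>act_low\<close> lets the maps act on one alphabet of \<open>f(x,y)\<close> at a time, the
  alphabet \<open>x\<close> occupying the variables below \<open>N\<close> before and below \<open>N'\<close> after the action. The instances
  are the strictly monotone maps (quasisymmetric series) and the injective maps (symmetric series).
\<close>

locale variable_maps =
  fixes G :: "(nat \<Rightarrow> nat) set"
  assumes inj: "g \<in> G \<Longrightarrow> inj g"
    and strict_mono: "strict_mono g \<Longrightarrow> g \<in> G"
    and act_high: "g \<in> G \<Longrightarrow> (\<lambda>i. if i < N then i else N + g (i - N)) \<in> G"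
    and act_low: "g \<in> G \<Longrightarrow> \<forall>i<N. g i < N' \<Longrightarrow> (\<lambda>i. if i < N then g i else N' + (i - N)) \<in> G"
begin

lemma invariantsD: "f \<in> invariants G \<Longrightarrow> g \<in> G \<Longrightarrow> f (image_mset g m) = f m"
  by (simp add: invariants_def)

lemma quasi: "f \<in> invariants G \<Longrightarrow> f \<in> quasisymmetric"
  using strict_mono by (auto simp: invariants_def)

end

interpretation quasi: variable_maps "{g. strict_mono g}"
proof
  fix g :: "nat \<Rightarrow> nat" and N N' :: nat
  assume g: "g \<in> {g. strict_mono g}"
  show "inj g" using g by (simp add: strict_mono_inj)
  show "(\<lambda>i. if i < N then i else N + g (i - N)) \<in> {g. strict_mono g}"
    using g by (auto simp: strict_mono_def)
  assume low: "\<forall>i<N. g i < N'"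
  have "(if i < N then g i else N' + (i - N)) < (if j < N then g j else N' + (j - N))"
    if "i < j" for i j
    using that g low[rule_format, of i] by (auto simp: strict_mono_def)
  then show "(\<lambda>i. if i < N then g i else N' + (i - N)) \<in> {g. strict_mono g}"
    by (auto simp: strict_mono_def)
qed simp

interpretation sym: variable_maps "{g. inj g}"
proof
  fix g :: "nat \<Rightarrow> nat" and N N' :: nat
  show "strict_mono g \<Longrightarrow> g \<in> {g. inj g}" by (simp add: strict_mono_inj)
  assume g: "g \<in> {g. inj g}"
  show "(\<lambda>i. if i < N then i else N + g (i - N)) \<in> {g. inj g}"
  proof (intro CollectI injI)
    fix i j assume "(if i < N then i else N + g (i - N)) = (if j < N then j else N + g (j - N))"
    then show "i = j" using g injD[of g "i - N" "j - N"] by (auto split: if_splits)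
  qed
  assume low: "\<forall>i<N. g i < N'"
  show "(\<lambda>i. if i < N then g i else N' + (i - N)) \<in> {g. inj g}"
  proof (intro CollectI injI)
    fix i j assume "(if i < N then g i else N' + (i - N)) = (if j < N then g j else N' + (j - N))"
    then show "i = j"
      using g injD[of g i j] low[rule_format, of i] low[rule_format, of j] by (auto split: if_splits)
  qed
qed simp

text \<open>Every orbit of monomials has a representative attached to an index, along which the
  family is unitriangular. The second claim provides the criterion by which the coproduct is shown
  to land in the completed tensor square.\<close>

lemma (in variable_maps) lincombs_eq_invariants:
  assumes I: "I \<subseteq> compositions" and u: "\<And>i. i \<in> I \<Longrightarrow> u i \<in> invariants G"
    and diag: "\<And>i. i \<in> I \<Longrightarrow> u i (monomial i) = 1"
    and nonzero: "\<And>i m. i \<in> I \<Longrightarrow> u i m \<noteq> 0 \<Longrightarrow> m = monomial i \<or> sum_list i < size m \<or>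
      (sum_list i = size m \<and> sum_mset (monomial i) < sum_mset m)"
    and reps: "\<And>m. \<exists>i\<in>I. \<exists>g\<in>G. m = image_mset g (monomial i)"
  shows "lincombs I u = invariants G"
    and "lincombs (I \<times> I) (\<lambda>(i, j). tensor (u i) (u j)) = invariants2 G"
proof -
  let ?rank = "\<lambda>i. size_weight_rank (monomial i)"
  have tri: "i = j \<or> ?rank i < ?rank j" if "i \<in> I" "j \<in> I" "u i (monomial j) \<noteq> 0" for i j
  proof (cases "monomial j = monomial i")
    case True
    then show ?thesis using monomial_inj[OF _ _ True[symmetric]] I that(1,2) by blast
  next
    case False
    then show ?thesis
      using nonzero[OF that(1,3)] rank_monomial_less[of i "monomial j"] I that(1) by blast
  qed
  have red: "\<exists>i\<in>I. \<forall>f\<in>invariants G. f m = f (monomial i)" for m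
    using reps[of m] invariantsD by blast
  have fin: "finite {i \<in> I. ?rank i \<le> n}" for n
    by (rule finite_rank_le[OF I])
  define E where "E = {(image_mset g m, m) |g m. g \<in> G}"
  have inv: "invariants G = {f. \<forall>(m, m')\<in>E. f m = f m'}"
    unfolding invariants_def E_def by blast
  show "lincombs I u = invariants G"
    unfolding inv
    by (rule lincombs_triangular[where rank = ?rank and rep = monomial])
      (use fin tri diag u red in \<open>auto simp flip: inv\<close>)
  define E2 where "E2 = {((image_mset g a, b), (a, b)) |g a b. g \<in> G} \<union>
    {((a, image_mset g b), (a, b)) |g a b. g \<in> G}"
  have inv2: "invariants2 G = {f. \<forall>(m, m')\<in>E2. f m = f m'}"
    unfolding invariants2_def E2_def by blast
  have slices: "(\<lambda>a. F (a, b)) \<in> invariants G" "(\<lambda>b. F (a, b)) \<in> invariants G"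
    if "F \<in> invariants2 G" for F a b
    using that unfolding invariants_def invariants2_def by auto
  show "lincombs (I \<times> I) (\<lambda>(i, j). tensor (u i) (u j)) = invariants2 G"
    unfolding inv2
  \<comment> \<open>Ranks add up: a nonzero coefficient makes each component equal or of smaller
    rank, with a strict drop in at least one unless the pairs agree.\<close>
  proof (rule lincombs_triangular[where rank = "\<lambda>(i, j). ?rank i + ?rank j"
        and rep = "\<lambda>(i, j). (monomial i, monomial j)"], unfold inv2[symmetric])
    fix n
    show "finite {p \<in> I \<times> I. (case p of (i, j) \<Rightarrow> ?rank i + ?rank j) \<le> n}"
      by (rule finite_subset[OF _ finite_cartesian_product[OF fin[of n] fin[of n]]]) auto
  next
    fix p q assume pq: "p \<in> I \<times> I" "q \<in> I \<times> I"
      "(case p of (i, j) \<Rightarrow> tensor (u i) (u j)) (case q of (i, j) \<Rightarrow> (monomial i, monomial j)) \<noteq> 0"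
    obtain i j i' j' where eq: "p = (i, j)" "q = (i', j')" by (cases p, cases q)
    have "i = i' \<or> ?rank i < ?rank i'" "j = j' \<or> ?rank j < ?rank j'"
      by (rule tri; use pq eq in \<open>auto simp: tensor_def\<close>)+
    then show "p = q \<or> (case p of (i, j) \<Rightarrow> ?rank i + ?rank j) < (case q of (i, j) \<Rightarrow> ?rank i + ?rank j)"
      unfolding eq by auto
  next
    fix p assume "p \<in> I \<times> I"
    then show "(case p of (i, j) \<Rightarrow> tensor (u i) (u j)) (case p of (i, j) \<Rightarrow> (monomial i, monomial j)) = 1"
      "(case p of (i, j) \<Rightarrow> tensor (u i) (u j)) \<in> invariants2 G"
      using diag u by (auto simp: tensor_def invariants2_def invariantsD)
  next
    fix m :: "nat multiset \<times> nat multiset"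
    obtain a b where m: "m = (a, b)" by (cases m)
    obtain i where i: "i \<in> I" "\<And>f. f \<in> invariants G \<Longrightarrow> f a = f (monomial i)" using red by blast
    obtain j where j: "j \<in> I" "\<And>f. f \<in> invariants G \<Longrightarrow> f b = f (monomial j)" using red by blast
    have "F (a, b) = F (monomial i, monomial j)" if "F \<in> invariants2 G" for F
      using i(2)[OF slices(1)[OF that]] j(2)[OF slices(2)[OF that]] by simp
    then show "\<exists>p\<in>I \<times> I. \<forall>F\<in>invariants2 G. F m = F (case p of (i, j) \<Rightarrow> (monomial i, monomial j))"
      unfolding m using i(1) j(1) by (intro bexI[of _ "(i, j)"]) auto
  qed
qed

section \<open>Representatives of monomials under renaming of variables\<close>

definition enumerate_vars :: "nat list \<Rightarrow> nat \<Rightarrow> nat" where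
  "enumerate_vars s k = (if k < length s then s ! k else Suc (sum_list s) + k)"

text \<open>The monomial only sees the variables below \<open>length s\<close>. The offset
  \<open>Suc (sum_list s)\<close> exceeds every entry of \<open>s\<close>, so the continuation to
  all naturals creates no collisions.\<close>

lemma inj_enumerate_vars:
  assumes "distinct s"
  shows "inj (enumerate_vars s)"
proof (rule injI)
  fix i j assume *: "enumerate_vars s i = enumerate_vars s j"
  have "s ! k < Suc (sum_list s)" if "k < length s" for k
    using that by (simp add: elem_le_sum_list less_Suc_eq_le)
  from this[of i] this[of j] show "i = j"
    using * assms by (auto simp: enumerate_vars_def nth_eq_iff_index_eq split: if_splits)
qed

lemma strict_mono_enumerate_vars:
  assumes "sorted_wrt (<) s"
  shows "strict_mono (enumerate_vars s)"
proof (rule strict_monoI)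
  fix i j :: nat assume *: "i < j"
  have "s ! k < Suc (sum_list s)" if "k < length s" for k
    using that by (simp add: elem_le_sum_list less_Suc_eq_le)
  from this[of i] this[of j] show "enumerate_vars s i < enumerate_vars s j"
    using * assms by (auto simp: enumerate_vars_def sorted_wrt_iff_nth_less)
qed

lemma image_mset_sum: "finite A \<Longrightarrow> image_mset g (sum h A) = (\<Sum>i\<in>A. image_mset g (h i))"
  by (induction A rule: finite_induct) auto

lemma image_enumerate_vars:
  assumes s: "distinct s" "set s = set_mset m"
  shows "image_mset (enumerate_vars s) (monomial (map (count m) s)) = m"
proof -
  have "image_mset (enumerate_vars s) (monomial (map (count m) s)) =
      (\<Sum>i<length s. replicate_mset (count m (s ! i)) (s ! i))"
    unfolding monomial_def by (simp add: image_mset_sum enumerate_vars_def)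
  also have "\<dots> = (\<Sum>x\<in>set s. replicate_mset (count m x) x)"
    using s(1) by (intro sum.reindex_bij_betw[OF bij_betw_nth]) auto
  also have "\<dots> = m"
    unfolding s(2) by (rule multiset_eqI) (auto simp: count_sum not_in_iff)
  finally show ?thesis .
qed

lemma quasi_reps: "\<exists>\<alpha>\<in>compositions. \<exists>g\<in>{g. strict_mono g}. m = image_mset g (monomial \<alpha>)"
  for m :: "nat multiset"
proof -
  let ?s = "sorted_list_of_set (set_mset m)"
  have "map (count m) ?s \<in> compositions"
    by (auto simp: compositions_def)
  moreover have "strict_mono (enumerate_vars ?s)"
    by (rule strict_mono_enumerate_vars) simp
  moreover have "m = image_mset (enumerate_vars ?s) (monomial (map (count m) ?s))"
    by (rule image_enumerate_vars[symmetric]) simp_all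
  ultimately show ?thesis by blast
qed

text \<open>Listing the variables by decreasing multiplicity turns the exponents into a partition;
  the resulting map is injective but in general not monotone.\<close>

lemma sym_reps: "\<exists>\<mu>\<in>partitions. \<exists>g\<in>{g. inj g}. m = image_mset g (monomial \<mu>)"
  for m :: "nat multiset"
proof -
  let ?s = "rev (sort_key (count m) (sorted_list_of_set (set_mset m)))"
  have "sorted (map (count m) (sort_key (count m) (sorted_list_of_set (set_mset m))))"
    by (rule sorted_sort_key)
  then have "map (count m) ?s \<in> partitions"
    by (auto simp: partitions_def rev_map[symmetric] sorted_wrt_rev)
  moreover have "inj (enumerate_vars ?s)"
    by (rule inj_enumerate_vars) simp
  moreover have "m = image_mset (enumerate_vars ?s) (monomial (map (count m) ?s))"
    by (rule image_enumerate_vars[symmetric]) simp_all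
  ultimately show ?thesis by blast
qed

lemma partitions_compositions: "partitions \<subseteq> compositions"
  by (auto simp: partitions_def compositions_def)

section \<open>Lowest terms of the multi-fundamental quasisymmetric functions\<close>

text \<open>For a position \<open>i\<close> this is the index, counted from 0, of the part of
  \<alpha> whose block contains \<open>i\<close>. It is also the least value that can occur at
  \<open>i\<close>, as each descent forces a strict increase.\<close>

definition descents_before :: "nat list \<Rightarrow> nat \<Rightarrow> nat" where
  "descents_before \<alpha> i = card {j \<in> partial_sums \<alpha>. j < i}"

text \<open>Prefixes make induction from the right natural. The full sum becomes a proper partial
  sum once a part is appended; the empty list is the exception, as 0 is never counted.\<close>

lemma partial_sums_snoc:
  "partial_sums (\<alpha> @ [k]) = partial_sums \<alpha> \<union> (if \<alpha> = [] then {} else {sum_list \<alpha>})"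
proof -
  have "partial_sums (\<alpha> @ [k]) = (\<lambda>i. sum_list (take i \<alpha>)) ` {1..<Suc (length \<alpha>)}"
    unfolding partial_sums_def by force
  also have "\<dots> = (\<lambda>i. sum_list (take i \<alpha>)) ` ({1..<length \<alpha>} \<union> (if \<alpha> = [] then {} else {length \<alpha>}))"
    by (intro arg_cong[where f = "\<lambda>A. _ ` A"]) (cases \<alpha>; auto)
  also have "\<dots> = partial_sums \<alpha> \<union> (if \<alpha> = [] then {} else {sum_list \<alpha>})"
    unfolding image_Un by (auto simp: partial_sums_def)
  finally show ?thesis .
qed

lemma partial_sums_less:
  assumes "\<alpha> \<in> compositions" "j \<in> partial_sums \<alpha>"
  shows "j < sum_list \<alpha>"
  using assms
proof (induction \<alpha> rule: rev_induct)
  case (snoc k \<alpha>)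
  then show ?case
    by (auto simp: partial_sums_snoc compositions_def split: if_splits)
qed (simp add: partial_sums_def)

lemma card_partial_sums:
  assumes "\<alpha> \<in> compositions"
  shows "card (partial_sums \<alpha>) = length \<alpha> - 1 \<and> finite (partial_sums \<alpha>)"
  using assms
proof (induction \<alpha> rule: rev_induct)
  case (snoc k \<alpha>)
  then have "\<alpha> \<in> compositions" by (simp add: compositions_def)
  moreover from this have "sum_list \<alpha> \<notin> partial_sums \<alpha>"
    using partial_sums_less by blast
  ultimately show ?case
    using snoc.IH by (cases "\<alpha> = []") (auto simp: partial_sums_snoc Suc_leI simp del: append_Nil)
qed (simp add: partial_sums_def)

lemma image_descents_before:
  assumes "\<alpha> \<in> compositions"
  shows "image_mset (descents_before \<alpha>) (mset_set {1..sum_list \<alpha>}) = monomial \<alpha>"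
  using assms
proof (induction \<alpha> rule: rev_induct)
  case (snoc k \<alpha>)
  then have \<alpha>: "\<alpha> \<in> compositions" by (simp add: compositions_def)
  let ?n = "sum_list \<alpha>"
  have split: "{1..sum_list (\<alpha> @ [k])} = {1..?n} \<union> {?n + 1..?n + k}" by auto
  have low: "descents_before (\<alpha> @ [k]) i = descents_before \<alpha> i" if "i \<le> ?n" for i
    using that unfolding descents_before_def partial_sums_snoc
    by (intro arg_cong[where f = card]) auto
  have high: "descents_before (\<alpha> @ [k]) i = length \<alpha>" if "?n < i" for i
  proof -
    have "{j \<in> partial_sums (\<alpha> @ [k]). j < i} = partial_sums (\<alpha> @ [k])"
    proof -
      have "j \<le> ?n" if "j \<in> partial_sums (\<alpha> @ [k])" for j
        using that partial_sums_less[OF \<alpha>, of j] by (auto simp: partial_sums_snoc split: if_splits)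
      then show ?thesis using that by fastforce
    qed
    then show ?thesis
      using card_partial_sums[OF snoc.prems] by (simp add: descents_before_def)
  qed
  have "image_mset (descents_before (\<alpha> @ [k])) (mset_set {1..sum_list (\<alpha> @ [k])}) =
      image_mset (descents_before (\<alpha> @ [k])) (mset_set {1..?n}) +
      image_mset (descents_before (\<alpha> @ [k])) (mset_set {?n + 1..?n + k})"
    unfolding split by (subst mset_set_Union) auto
  also have "image_mset (descents_before (\<alpha> @ [k])) (mset_set {1..?n}) =
      image_mset (descents_before \<alpha>) (mset_set {1..?n})"
    by (rule image_mset_cong) (simp add: low)
  also have "image_mset (descents_before (\<alpha> @ [k])) (mset_set {?n + 1..?n + k}) =
      image_mset (\<lambda>_. length \<alpha>) (mset_set {?n + 1..?n + k})"
    by (rule image_mset_cong) (simp add: high)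
  finally show ?case
    using snoc.IH[OF \<alpha>] by (simp add: monomial_snoc image_mset_const_eq)
qed (simp add: monomial_def)

lemma descents_before_Suc:
  assumes "\<alpha> \<in> compositions"
  shows "descents_before \<alpha> (Suc i) = descents_before \<alpha> i + (if i \<in> partial_sums \<alpha> then 1 else 0)"
proof -
  have "{j \<in> partial_sums \<alpha>. j < Suc i} =
      (if i \<in> partial_sums \<alpha> then insert i {j \<in> partial_sums \<alpha>. j < i} else {j \<in> partial_sums \<alpha>. j < i})"
    by (auto simp: less_Suc_eq)
  then show ?thesis
    using card_partial_sums[OF assms] by (simp add: descents_before_def)
qed

context
  fixes \<alpha> :: "nat list" assumes \<alpha>: "\<alpha> \<in> compositions"
begin

text \<open>Injectivity excludes equality, so ascents and descents are complementary. The chosen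
  permutation thus enters only through \<open>partial_sums\<close>.\<close>

lemma perm_step:
  assumes "1 \<le> i" "i < sum_list \<alpha>"
  shows "perm_of_composition \<alpha> i > perm_of_composition \<alpha> (Suc i) \<longleftrightarrow> i \<in> partial_sums \<alpha>"
    and "perm_of_composition \<alpha> i < perm_of_composition \<alpha> (Suc i) \<longleftrightarrow> i \<notin> partial_sums \<alpha>"
proof -
  show *: "perm_of_composition \<alpha> i > perm_of_composition \<alpha> (Suc i) \<longleftrightarrow> i \<in> partial_sums \<alpha>"
    using perm_of_composition(2)[OF \<alpha>] assms unfolding descents_def by auto
  have "perm_of_composition \<alpha> i \<noteq> perm_of_composition \<alpha> (Suc i)"
    using permutes_inj[OF perm_of_composition(1)[OF \<alpha>]] by (metis injD n_not_Suc_n)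
  then show "perm_of_composition \<alpha> i < perm_of_composition \<alpha> (Suc i) \<longleftrightarrow> i \<notin> partial_sums \<alpha>"
    using * by linarith
qed

lemma Ltilde_lower:
  assumes T: "T \<in> {1..sum_list \<alpha>} \<rightarrow>\<^sub>E {A. finite A \<and> A \<noteq> {}}"
    and P: "set_valued_partition (sum_list \<alpha>) (perm_of_composition \<alpha>) T"
    and "i \<in> {1..sum_list \<alpha>}" "x \<in> T i"
  shows "descents_before \<alpha> i \<le> x"
  using assms(3,4)
proof (induction i arbitrary: x)
  case (Suc i)
  show ?case
  proof (cases "i = 0")
    case True
    \<comment> \<open>At position 1 no descent may be counted; positivity of the parts ensures
      this.\<close>
    have "0 \<notin> partial_sums \<alpha>"
    proof
      assume "0 \<in> partial_sums \<alpha>"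
      then obtain k where "1 \<le> k" "k < length \<alpha>" "sum_list (take k \<alpha>) = 0"
        unfolding partial_sums_def by auto
      then have "\<alpha> ! 0 = 0" "\<alpha> ! 0 \<in> set \<alpha>"
        by (cases \<alpha>; cases k; simp)+
      then show False using \<alpha> by (auto simp: compositions_def)
    qed
    then have "{j \<in> partial_sums \<alpha>. j < Suc 0} = {}" by auto
    then show ?thesis by (simp only: True descents_before_def card.empty le0)
  next
    case False
    then have i: "1 \<le> i" "i < sum_list \<alpha>" "i \<in> {1..sum_list \<alpha>}" using Suc.prems by auto
    have fin: "finite (T i)" "T i \<noteq> {}" "finite (T (Suc i))"
      using PiE_mem[OF T i(3)] PiE_mem[OF T Suc.prems(1)] by auto
    have le: "descents_before \<alpha> i \<le> Max (T i)"
      by (rule Suc.IH[OF i(3)]) (use fin in simp)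
    have "Min (T (Suc i)) \<le> x" using fin Suc.prems by simp
    moreover have "i \<in> partial_sums \<alpha> \<Longrightarrow> Max (T i) < Min (T (Suc i))"
      "i \<notin> partial_sums \<alpha> \<Longrightarrow> Max (T i) \<le> Min (T (Suc i))"
      using P i perm_step[OF i(1,2)] unfolding set_valued_partition_def by auto
    ultimately show ?thesis
      using le by (auto simp: descents_before_Suc[OF \<alpha>])
  qed
qed simp

lemma Ltilde_minimal:
  "set_valued_partition (sum_list \<alpha>) (perm_of_composition \<alpha>)
     (\<lambda>i\<in>{1..sum_list \<alpha>}. {descents_before \<alpha> i})"
  unfolding set_valued_partition_def
  using perm_step by (auto simp: descents_before_Suc[OF \<alpha>])

lemma Ltilde_monomial: "Ltilde \<alpha> (monomial \<alpha>) = 1"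
  using set_valued_series_lowest[where B = "{1..sum_list \<alpha>}"
      and P = "set_valued_partition (sum_list \<alpha>) (perm_of_composition \<alpha>)"
      and d = "descents_before \<alpha>",
      OF _ Ltilde_lower Ltilde_minimal]
  unfolding Ltilde_def image_descents_before[OF \<alpha>] by simp

lemma Ltilde_nonzero:
  assumes "Ltilde \<alpha> m \<noteq> 0"
  shows "m = monomial \<alpha> \<or> sum_list \<alpha> < size m \<or>
    (sum_list \<alpha> = size m \<and> sum_mset (monomial \<alpha>) < sum_mset m)"
  using set_valued_series_nonzero[where B = "{1..sum_list \<alpha>}"
      and P = "set_valued_partition (sum_list \<alpha>) (perm_of_composition \<alpha>)"
      and d = "descents_before \<alpha>" and m = m,
      OF _ Ltilde_lower Ltilde_minimal] assms
    sum_unfold_sum_mset[of "descents_before \<alpha>" "{1..sum_list \<alpha>}"]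
  unfolding Ltilde_def image_descents_before[OF \<alpha>] by simp

end

lemma Ltilde_quasisymmetric: "Ltilde \<alpha> \<in> quasisymmetric"
  by (simp add: invariants_def Ltilde_image)

lemma space_mQSym: "space_of mQSym = quasisymmetric"
  and tensor_square_mQSym: "tensor_square mQSym = invariants2 {g. strict_mono g}"
  using quasi.lincombs_eq_invariants[OF order.refl Ltilde_quasisymmetric Ltilde_monomial Ltilde_nonzero
      quasi_reps]
  by (simp_all add: space_of_def tensor_square_def mQSym_def)

section \<open>Lowest terms of set-valued tableaux and Schur functions\<close>

lemma image_fst_boxes: "image_mset fst (mset_set (boxes \<mu>)) = monomial \<mu>"
proof (rule multiset_eqI)
  fix i
  have "count (image_mset fst (mset_set (boxes \<mu>))) i = card (boxes \<mu> \<inter> fst -` {i})"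
    using finite_boxes[of \<mu>] by (simp add: count_image_mset Int_commute)
  also have "boxes \<mu> \<inter> fst -` {i} = (if i < length \<mu> then Pair i ` {..<\<mu> ! i} else {})"
    by (auto simp: boxes_def)
  finally show "count (image_mset fst (mset_set (boxes \<mu>))) i = count (monomial \<mu>) i"
    by (simp add: count_monomial card_image inj_on_def)
qed

context
  fixes \<mu> :: "nat list" assumes \<mu>: "\<mu> \<in> partitions"
begin

text \<open>Each step down a column raises the entries by at least one, so the row index is the
  smallest possible entry.\<close>

lemma Ktilde_lower:
  assumes T: "T \<in> boxes \<mu> \<rightarrow>\<^sub>E {A. finite A \<and> A \<noteq> {}}" and P: "set_valued_tableau \<mu> T"
    and "b \<in> boxes \<mu>" "x \<in> T b"
  shows "fst b \<le> x"
proof -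
  have "i \<le> x" if "(i, j) \<in> boxes \<mu>" "x \<in> T (i, j)" for i j x
    using that
  proof (induction i arbitrary: x)
    case (Suc i)
    have box: "(i, j) \<in> boxes \<mu>" by (rule boxes_antimono[OF \<mu> Suc.prems(1)]) auto
    then obtain y where y: "y \<in> T (i, j)" using PiE_mem[OF T] by blast
    have "columns_strictly_increase (boxes \<mu>) T"
      using P set_valued_tableau_iff[OF \<mu> T] by blast
    then have "y < x"
      using box Suc.prems y unfolding columns_strictly_increase_def by blast
    then show ?case using Suc.IH[OF box y] by simp
  qed simp
  then show ?thesis using assms(3,4) by (cases b) auto
qed

lemma Ktilde_minimal: "set_valued_tableau \<mu> (\<lambda>b\<in>boxes \<mu>. {fst b})"
  unfolding set_valued_tableau_def by auto

lemma Ktilde_monomial: "Ktilde \<mu> (monomial \<mu>) = 1"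
  using set_valued_series_lowest[where B = "boxes \<mu>"
      and P = "set_valued_tableau \<mu>" and d = fst,
      OF finite_boxes Ktilde_lower Ktilde_minimal]
  unfolding Ktilde_def image_fst_boxes by simp

lemma Ktilde_nonzero:
  assumes "Ktilde \<mu> m \<noteq> 0"
  shows "m = monomial \<mu> \<or> sum_list \<mu> < size m \<or>
    (sum_list \<mu> = size m \<and> sum_mset (monomial \<mu>) < sum_mset m)"
  using set_valued_series_nonzero[where B = "boxes \<mu>"
      and P = "set_valued_tableau \<mu>" and d = fst and m = m,
      OF finite_boxes Ktilde_lower Ktilde_minimal] assms
    sum_unfold_sum_mset[of fst "boxes \<mu>"]
  unfolding Ktilde_def image_fst_boxes card_boxes by simp

lemma Ktilde_symmetric: "Ktilde \<mu> \<in> symmetric"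
  by (simp add: invariants_def Ktilde_image[OF \<mu>])

end

text \<open>When the size of the monomial equals the number of boxes, all sets are singletons, so
  the Schur function is the lowest degree part of \<open>Ktilde\<close>. Symmetry and triangularity
  of \<open>schur\<close> are inherited this way.\<close>

lemma schur_eq_Ktilde: "schur \<mu> m = (if size m = sum_list \<mu> then Ktilde \<mu> m else 0)"
proof (cases "size m = sum_list \<mu>")
  case False
  then have "image_mset T (mset_set (boxes \<mu>)) \<noteq> m" for T :: "_ \<Rightarrow> nat"
    by (auto simp: card_boxes)
  then show ?thesis using False by (simp add: schur_def)
next
  case True
  let ?B = "boxes \<mu>"
  let ?X = "{T \<in> ?B \<rightarrow>\<^sub>E UNIV. semistandard_tableau \<mu> T \<and> image_mset T (mset_set ?B) = m}"
  let ?Y = "{T \<in> ?B \<rightarrow>\<^sub>E {A. finite A \<and> A \<noteq> {}}. set_valued_tableau \<mu> T \<and>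
    (\<Sum>b\<in>?B. mset_set (T b)) = m}"
  let ?f = "\<lambda>T. \<lambda>b\<in>?B. {T b}" and ?g = "\<lambda>U. \<lambda>b\<in>?B. Min (U b)"
  have content: "(\<Sum>b\<in>?B. mset_set {T b}) = image_mset T (mset_set ?B)" for T :: "_ \<Rightarrow> nat"
    using finite_boxes[of \<mu>] by induction auto
  have tab: "set_valued_tableau \<mu> (?f T) \<longleftrightarrow> semistandard_tableau \<mu> T" for T
    unfolding set_valued_tableau_def semistandard_tableau_def
    by (intro iff_allI imp_cong refl) auto
  have f: "?f T \<in> ?Y" "?g (?f T) = T" if T: "T \<in> ?X" for T
  proof -
    have "(\<Sum>b\<in>?B. mset_set (?f T b)) = (\<Sum>b\<in>?B. mset_set {T b})"
      by (intro sum.cong) auto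
    then show "?f T \<in> ?Y"
      using T tab[of T] content[of T] by auto
    have "T \<in> extensional ?B" using T by (auto simp: PiE_def)
    then show "?g (?f T) = T"
      by (intro ext) (auto simp: extensional_def)
  qed
  have g: "?g U \<in> ?X" "?f (?g U) = U" if U: "U \<in> ?Y" for U
  proof -
    obtain t where t: "\<And>b. b \<in> ?B \<Longrightarrow> U b = {t b}"
      using singleton_filling[OF finite_boxes, of U \<mu> m] U True by (auto simp: card_boxes)
    have "U \<in> extensional ?B" using U by (auto simp: PiE_def)
    then show U_eq: "?f (?g U) = U"
      using t by (intro ext) (auto simp: extensional_def)
    have "(\<Sum>b\<in>?B. mset_set (?f (?g U) b)) = (\<Sum>b\<in>?B. mset_set {?g U b})"
      by (intro sum.cong) auto
    then have "image_mset (?g U) (mset_set ?B) = m"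
      using U content[of "?g U"] unfolding U_eq by simp
    moreover have "semistandard_tableau \<mu> (?g U)"
      using U tab[of "?g U"] unfolding U_eq by simp
    ultimately show "?g U \<in> ?X" by simp
  qed
  have "bij_betw ?f ?X ?Y"
    by (rule bij_betw_byWitness[where f' = ?g]; intro ballI image_subsetI f g; assumption)
  then have "card ?X = card ?Y" by (rule bij_betw_same_card)
  then show ?thesis
    using True by (simp add: schur_def Ktilde_def set_valued_series_def)
qed

lemma space_mSym: "space_of mSym = symmetric"
  and tensor_square_mSym: "tensor_square mSym = invariants2 {g. inj g}"
  using sym.lincombs_eq_invariants[OF partitions_compositions Ktilde_symmetric Ktilde_monomial
      Ktilde_nonzero sym_reps]
  by (simp_all add: space_of_def tensor_square_def mSym_def)

lemma space_Sym_hat: "space_of Sym_hat = symmetric"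
  and tensor_square_Sym_hat: "tensor_square Sym_hat = invariants2 {g. inj g}"
proof -
  have "schur \<mu> \<in> symmetric" if "\<mu> \<in> partitions" for \<mu>
    using Ktilde_image[OF that] by (simp add: invariants_def schur_eq_Ktilde)
  moreover have "schur \<mu> (monomial \<mu>) = 1" if "\<mu> \<in> partitions" for \<mu>
    using Ktilde_monomial[OF that] by (simp add: schur_eq_Ktilde size_monomial)
  moreover have "m = monomial \<mu> \<or> sum_list \<mu> < size m \<or>
      (sum_list \<mu> = size m \<and> sum_mset (monomial \<mu>) < sum_mset m)"
    if "\<mu> \<in> partitions" "schur \<mu> m \<noteq> 0" for \<mu> m
    by (rule Ktilde_nonzero[OF that(1)]) (use that(2) in \<open>auto simp: schur_eq_Ktilde split: if_splits\<close>)
  ultimately show "space_of Sym_hat = symmetric" "tensor_square Sym_hat = invariants2 {g. inj g}"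
    using sym.lincombs_eq_invariants[OF partitions_compositions, of schur] sym_reps
    by (simp_all add: space_of_def tensor_square_def Sym_hat_def)
qed


section \<open>Hopf structure on invariant series\<close>

definition splits :: "'a multiset \<Rightarrow> ('a multiset \<times> 'a multiset) set" where
  "splits m = {(a, b). a + b = m}"

lemma finite_splits: "finite (splits m)"
proof (rule finite_subset)
  have "b = m - a" if "(a, b) \<in> splits m" for a b
    using that by (auto simp: splits_def)
  then show "splits m \<subseteq> (\<lambda>a. (a, m - a)) ` {a. a \<subseteq># m}"
    by (force simp: splits_def)
  have "finite {a. a \<subseteq># m}"
  proof (rule finite_subset)
    show "{a. a \<subseteq># m} \<subseteq> mset ` {xs. set xs \<subseteq> set_mset m \<and> length xs \<le> size m}"
    proof
      fix a assume "a \<in> {a. a \<subseteq># m}"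
      moreover obtain xs where "a = mset xs" by (metis ex_mset)
      ultimately show "a \<in> mset ` {xs. set xs \<subseteq> set_mset m \<and> length xs \<le> size m}"
        using set_mset_mono[of a m] size_mset_mono[of a m] by auto
    qed
  qed (simp add: finite_lists_length_le)
  then show "finite ((\<lambda>a. (a, m - a)) ` {a. a \<subseteq># m})" by simp
qed

lemma image_mset_inj_iff: "inj g \<Longrightarrow> image_mset g a = image_mset g b \<longleftrightarrow> a = b"
  by (metis multiset.inj_map injD)

lemma sum_splits_image:
  assumes "inj g"
  shows "(\<Sum>(a, b)\<in>splits (image_mset g m). F a b) =
    (\<Sum>(a, b)\<in>splits m. F (image_mset g a) (image_mset g b))"
proof -
  let ?g = "map_prod (image_mset g) (image_mset g)"
  have "splits (image_mset g m) = ?g ` splits m"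
  proof (intro equalityI subsetI)
    fix p assume "p \<in> splits (image_mset g m)"
    then obtain a b where p: "p = (a, b)" "image_mset g m = a + b"
      by (auto simp: splits_def)
    then show "p \<in> ?g ` splits m"
      using image_mset_eq_plusD[OF p(2)] by (force simp: splits_def)
  qed (auto simp: splits_def)
  moreover have "inj_on ?g (splits m)"
    by (auto simp: inj_on_def image_mset_inj_iff[OF assms])
  ultimately show ?thesis
    by (simp add: sum.reindex case_prod_unfold)
qed

lemma splits_empty: "splits {#} = {({#}, {#})}"
  by (auto simp: splits_def)

lemma series_mult_splits: "(f \<otimes>\<^sub>s g) m = (\<Sum>(a, b)\<in>splits m. f a * g b)"
  unfolding series_mult_def splits_def ..

lemma codiagonal_splits: "codiagonal F m = (\<Sum>(a, b)\<in>splits m. F (a, b))"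
  unfolding codiagonal_def splits_def ..

definition shift :: "nat \<Rightarrow> nat multiset \<Rightarrow> nat multiset" where
  "shift N b = image_mset ((+) N) b"

lemma shift_simps [simp]: "shift N {#} = {#}" "shift N (a + b) = shift N a + shift N b"
    "shift M (shift N a) = shift (M + N) a" "shift 0 a = a" "size (shift N a) = size a"
proof -
  show "shift M (shift N a) = shift (M + N) a"
    unfolding shift_def multiset.map_comp by (rule image_mset_cong) simp
  show "shift 0 a = a"
    unfolding shift_def by (rule trans[OF image_mset_cong[of _ _ id]]) simp_all
qed (simp_all add: shift_def)

text \<open>A map defined by cases at \<open>N\<close> acts on the two alphabets independently;
  \<open>q\<close> sees the second one with its indices counted from 0.\<close>

lemma image_mset_shift:
  assumes "\<forall>i\<in>#a. i < N"
  shows "image_mset (\<lambda>i. if i < N then p i else q (i - N)) (a + shift N b) =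
    image_mset p a + image_mset q b"
proof -
  have "image_mset (\<lambda>i. if i < N then p i else q (i - N)) a = image_mset p a"
    using assms by (intro image_mset_cong) simp
  moreover have "image_mset (\<lambda>i. if i < N then p i else q (i - N)) (shift N b) = image_mset q b"
    unfolding shift_def multiset.map_comp by (rule image_mset_cong) simp
  ultimately show ?thesis by simp
qed

text \<open>Frees the coproduct from the least bound, so that one \<open>N\<close> can serve several
  monomials at once.\<close>

lemma coproduct_shift:
  assumes "f \<in> quasisymmetric" and "\<forall>i\<in>#a. i < N"
  shows "coproduct f (a, b) = f (a + shift N b)"
  using coproduct_eq[of f a N b] assms by (simp add: space_mQSym shift_def)

lemma ex_bound: "\<exists>N. \<forall>i\<in>#a. i < N" for a :: "nat multiset"
  using finite_nat_set_iff_bounded[of "set_mset a"] by simp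

lemma coproduct_counit: "coproduct f (a, {#}) = f a"
  and counit_coproduct: "coproduct f ({#}, b) = f b"
  by (simp_all add: coproduct_def var_bound_def flip: shift_def)

section \<open>Recursive construction of the antipode\<close>

text \<open>The left antipode identity, solved for its term with empty second factor, whose slice of
  the coproduct is \<open>f\<close> itself. All other terms are evaluated at smaller monomials,
  though on other series, so the size of \<open>m\<close> is what decreases.
  \<open>coantipode\<close> solves the right identity in the same way.\<close>

function antipode :: "xseries \<Rightarrow> xseries" where
  "antipode f m = (if m = {#} then f {#} else 0) -
     (\<Sum>p\<in>{p \<in> splits m. snd p \<noteq> {#}}. antipode (\<lambda>a. coproduct f (a, snd p)) (fst p))"
  by pat_completeness auto
termination
  by (relation "inv_image less_than (\<lambda>(f, m). size m)") (auto simp: splits_def nonempty_has_size)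

function coantipode :: "xseries \<Rightarrow> xseries" where
  "coantipode f m = (if m = {#} then f {#} else 0) -
     (\<Sum>p\<in>{p \<in> splits m. fst p \<noteq> {#}}. coantipode (\<lambda>b. coproduct f (fst p, b)) (snd p))"
  by pat_completeness auto
termination
  by (relation "inv_image less_than (\<lambda>(f, m). size m)") (auto simp: splits_def nonempty_has_size)

declare antipode.simps [simp del] coantipode.simps [simp del]

lemma antipode_empty: "antipode f {#} = f {#}"
  and coantipode_empty: "coantipode f {#} = f {#}"
  by (simp_all add: antipode.simps[of f] coantipode.simps[of f] splits_def)

lemma antipode_left: "(\<Sum>(a, b)\<in>splits m. antipode (\<lambda>a. coproduct f (a, b)) a) = series_const (counit f) m"
proof -
  have "splits m = insert (m, {#}) {p \<in> splits m. snd p \<noteq> {#}}"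
    by (auto simp: splits_def)
  then have "(\<Sum>(a, b)\<in>splits m. antipode (\<lambda>a. coproduct f (a, b)) a) =
      (\<Sum>(a, b)\<in>insert (m, {#}) {p \<in> splits m. snd p \<noteq> {#}}. antipode (\<lambda>a. coproduct f (a, b)) a)"
    by simp
  also have "\<dots> = antipode f m +
      (\<Sum>p\<in>{p \<in> splits m. snd p \<noteq> {#}}. antipode (\<lambda>a. coproduct f (a, snd p)) (fst p))"
    by (subst sum.insert) (simp_all add: finite_splits coproduct_counit case_prod_unfold)
  finally show ?thesis
    by (simp add: antipode.simps[of f m] series_const_def counit_def)
qed

lemma coantipode_right: "(\<Sum>(a, b)\<in>splits m. coantipode (\<lambda>b. coproduct f (a, b)) b) = series_const (counit f) m"
proof -
  have "splits m = insert ({#}, m) {p \<in> splits m. fst p \<noteq> {#}}"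
    by (auto simp: splits_def)
  then have "(\<Sum>(a, b)\<in>splits m. coantipode (\<lambda>b. coproduct f (a, b)) b) =
      (\<Sum>(a, b)\<in>insert ({#}, m) {p \<in> splits m. fst p \<noteq> {#}}. coantipode (\<lambda>b. coproduct f (a, b)) b)"
    by simp
  also have "\<dots> = coantipode f m +
      (\<Sum>p\<in>{p \<in> splits m. fst p \<noteq> {#}}. coantipode (\<lambda>b. coproduct f (fst p, b)) (snd p))"
    by (subst sum.insert) (simp_all add: finite_splits counit_coproduct case_prod_unfold)
  finally show ?thesis
    by (simp add: coantipode.simps[of f m] series_const_def counit_def)
qed

text \<open>Summing over all of \<open>splits m\<close> lets reindexing and linearity of sums apply
  without a side condition on the index set.\<close>

lemma antipode_eq:
  "antipode f m = (if m = {#} then f {#} else 0) -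
     (\<Sum>(a, b)\<in>splits m. if b = {#} then 0 else antipode (\<lambda>a. coproduct f (a, b)) a)"
  unfolding antipode.simps[of f m] sum.inter_filter[OF finite_splits]
  by (intro arg_cong2[where f = "(-)"] sum.cong) (auto simp: case_prod_unfold)

definition proper_splits :: "'a multiset \<Rightarrow> ('a multiset \<times> 'a multiset) set" where
  "proper_splits m = {(a, b). a + b = m \<and> a \<noteq> {#} \<and> b \<noteq> {#}}"

lemma finite_proper_splits: "finite (proper_splits m)"
  by (rule finite_subset[OF _ finite_splits[of m]]) (auto simp: proper_splits_def splits_def)

text \<open>The term with empty first factor is \<open>f m\<close>, since at the empty monomial the
  antipode just evaluates. With both extreme terms removed, this recursion and that of
  \<open>coantipode\<close> run over the same index set.\<close>

lemma antipode_proper: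
  assumes "m \<noteq> {#}"
  shows "antipode f m = - f m - (\<Sum>(a, b)\<in>proper_splits m. antipode (\<lambda>a. coproduct f (a, b)) a)"
proof -
  have "{p \<in> splits m. snd p \<noteq> {#}} = insert ({#}, m) (proper_splits m)"
    using assms by (auto simp: splits_def proper_splits_def)
  moreover have "({#}, m) \<notin> proper_splits m" by (simp add: proper_splits_def)
  ultimately show ?thesis
    using assms unfolding antipode.simps[of f m]
    by (simp add: finite_proper_splits antipode_empty counit_coproduct case_prod_unfold)
qed

lemma coantipode_proper:
  assumes "m \<noteq> {#}"
  shows "coantipode f m = - f m - (\<Sum>(a, b)\<in>proper_splits m. coantipode (\<lambda>b. coproduct f (a, b)) b)"
proof -
  have "{p \<in> splits m. fst p \<noteq> {#}} = insert (m, {#}) (proper_splits m)"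
    using assms by (auto simp: splits_def proper_splits_def)
  moreover have "(m, {#}) \<notin> proper_splits m" by (simp add: proper_splits_def)
  ultimately show ?thesis
    using assms unfolding coantipode.simps[of f m]
    by (simp add: finite_proper_splits coantipode_empty coproduct_counit case_prod_unfold)
qed

lemma antipode_add: "antipode (f \<oplus>\<^sub>s h) = antipode f \<oplus>\<^sub>s antipode h"
proof (rule ext)
  fix m
  show "antipode (f \<oplus>\<^sub>s h) m = (antipode f \<oplus>\<^sub>s antipode h) m"
  proof (induction "size m" arbitrary: m f h rule: less_induct)
    case less
    have "antipode (\<lambda>a. coproduct (f \<oplus>\<^sub>s h) (a, b)) a =
        antipode (\<lambda>a. coproduct f (a, b)) a + antipode (\<lambda>a. coproduct h (a, b)) a"
      if "(a, b) \<in> splits m" "b \<noteq> {#}" for a b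
    proof -
      have "size a < size m" using that by (auto simp: splits_def nonempty_has_size)
      moreover have "(\<lambda>a. coproduct (f \<oplus>\<^sub>s h) (a, b)) =
          (\<lambda>a. coproduct f (a, b)) \<oplus>\<^sub>s (\<lambda>a. coproduct h (a, b))"
        by (simp add: series_add_def coproduct_def)
      ultimately show ?thesis using less by (simp add: series_add_def)
    qed
    then have "(\<Sum>(a, b)\<in>splits m. if b = {#} then 0 else antipode (\<lambda>a. coproduct (f \<oplus>\<^sub>s h) (a, b)) a) =
        (\<Sum>(a, b)\<in>splits m. (if b = {#} then 0 else antipode (\<lambda>a. coproduct f (a, b)) a) +
          (if b = {#} then 0 else antipode (\<lambda>a. coproduct h (a, b)) a))"
      by (intro sum.cong) auto
    also have "\<dots> = (\<Sum>(a, b)\<in>splits m. if b = {#} then 0 else antipode (\<lambda>a. coproduct f (a, b)) a) +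
        (\<Sum>(a, b)\<in>splits m. if b = {#} then 0 else antipode (\<lambda>a. coproduct h (a, b)) a)"
      by (simp add: case_prod_unfold sum.distrib)
    finally show ?case
      unfolding series_add_def[of "antipode f"] antipode_eq[of _ m]
      by (simp only:) (simp add: series_add_def)
  qed
qed

text \<open>Each coefficient is built by finitely many steps from coefficients of \<open>f\<close>,
  so continuity follows by induction on the size of the monomial.\<close>

lemma continuous_antipode: "continuous_on UNIV antipode"
proof (rule continuous_on_coordinatewise_then_product)
  fix m
  show "continuous_on UNIV (\<lambda>f. antipode f m)"
  proof (induction "size m" arbitrary: m rule: less_induct)
    case less
    have slice: "continuous_on UNIV (\<lambda>f. antipode (\<lambda>a. coproduct f (a, b)) a)"
      if "(a, b) \<in> splits m" "b \<noteq> {#}" for a b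
    proof -
      have "size a < size m" using that by (auto simp: splits_def nonempty_has_size)
      moreover have "continuous_on UNIV (\<lambda>f. (\<lambda>a. coproduct f (a, b)))"
        by (rule continuous_on_coordinatewise_then_product)
          (rule continuous_on_product_then_coordinatewise[OF continuous_coproduct])
      ultimately show ?thesis
        using continuous_on_compose2[OF less, of a UNIV "\<lambda>f a. coproduct f (a, b)"] by simp
    qed
    have "continuous_on UNIV (\<lambda>f :: xseries. if m = {#} then f {#} else 0)"
      using continuous_on_product_then_coordinatewise[OF continuous_on_id] by (cases "m = {#}") auto
    moreover have "continuous_on UNIV (\<lambda>f. if snd p = {#} then 0 else
        antipode (\<lambda>a. coproduct f (a, snd p)) (fst p))" if "p \<in> splits m" for p
      using slice[of "fst p" "snd p"] that by (cases "snd p = {#}") simp_all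
    ultimately have "continuous_on UNIV (\<lambda>f. (if m = {#} then f {#} else 0) +
        (-1) * (\<Sum>p\<in>splits m. if snd p = {#} then 0 else
          antipode (\<lambda>a. coproduct f (a, snd p)) (fst p)))"
      by (intro continuous_on_add continuous_on_mult' continuous_on_sum continuous_on_const)
    then show ?case
      unfolding antipode_eq[of _ m] case_prod_unfold by simp
  qed
qed

section \<open>Invariant series are closed under the Hopf operations\<close>

context variable_maps
begin

lemma coproduct_invariant:
  assumes "f \<in> invariants G"
  shows "coproduct f \<in> invariants2 G"
proof -
  have "coproduct f (image_mset g a, b) = coproduct f (a, b) \<and>
      coproduct f (a, image_mset g b) = coproduct f (a, b)" if g: "g \<in> G" for g a b
  proof
    obtain N where N: "\<forall>i\<in>#a. i < N" using ex_bound by blast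
    \<comment> \<open>The bound covers the images of all indices below \<open>N\<close>, not only
      those in \<open>a\<close>: the combined map has to be an admissible map on all
      variables.\<close>
    obtain N' where N': "\<forall>i<N. g i < N'"
      using finite_nat_set_iff_bounded[of "g ` {..<N}"] by auto
    have eq: "coproduct f (a, b) = f (a + shift N b)" for b
      by (rule coproduct_shift[OF quasi[OF assms] N])
    let ?h = "\<lambda>i. if i < N then g i else N' + (i - N)"
    have "image_mset ?h (a + shift N b) = image_mset g a + shift N' b"
      unfolding image_mset_shift[OF N, of g "\<lambda>i. N' + i"] by (simp add: shift_def)
    moreover have "coproduct f (image_mset g a, b) = f (image_mset g a + shift N' b)"
      by (rule coproduct_shift[OF quasi[OF assms]]) (use N N' in auto)
    ultimately show "coproduct f (image_mset g a, b) = coproduct f (a, b)"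
      using invariantsD[OF assms act_low[OF g N'], of "a + shift N b"] eq by simp
    let ?h = "\<lambda>i. if i < N then i else N + g (i - N)"
    have "image_mset ?h (a + shift N b) = a + shift N (image_mset g b)"
      unfolding image_mset_shift[OF N, of "\<lambda>i. i" "\<lambda>i. N + g i"]
      by (simp add: shift_def multiset.map_comp comp_def)
    then show "coproduct f (a, image_mset g b) = coproduct f (a, b)"
      using invariantsD[OF assms act_high[OF g, of N], of "a + shift N b"] eq by simp
  qed
  then show ?thesis unfolding invariants2_def by blast
qed

lemma left_slice: "f \<in> invariants G \<Longrightarrow> (\<lambda>a. coproduct f (a, b)) \<in> invariants G"
  and right_slice: "f \<in> invariants G \<Longrightarrow> (\<lambda>b. coproduct f (a, b)) \<in> invariants G"
  using coproduct_invariant[of f] unfolding invariants_def invariants2_def by auto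

text \<open>Both sides are the coefficient of \<open>f\<close> at \<open>a\<close>, \<open>b\<close>
  and \<open>c\<close> placed in three consecutive blocks of variables.\<close>

lemma coproduct_coassoc:
  assumes "f \<in> invariants G"
  shows "coproduct (\<lambda>a. coproduct f (a, c)) (a, b) = coproduct (\<lambda>b. coproduct f (a, b)) (b, c)"
proof -
  obtain N where N: "\<forall>i\<in>#a. i < N" using ex_bound by blast
  obtain N' where N': "\<forall>i\<in>#b. i < N'" using ex_bound by blast
  have "coproduct (\<lambda>a. coproduct f (a, c)) (a, b) = coproduct f (a + shift N b, c)"
    by (rule coproduct_shift[OF quasi[OF left_slice[OF assms]] N])
  also have "\<dots> = f (a + shift N b + shift (N + N') c)"
    by (rule coproduct_shift[OF quasi[OF assms]]) (use N N' in \<open>auto simp: shift_def\<close>)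
  also have "\<dots> = f (a + shift N (b + shift N' c))"
    by (simp add: add.assoc)
  also have "\<dots> = coproduct f (a, b + shift N' c)"
    by (rule coproduct_shift[OF quasi[OF assms] N, symmetric])
  also have "\<dots> = coproduct (\<lambda>b. coproduct f (a, b)) (b, c)"
    by (rule coproduct_shift[OF quasi[OF right_slice[OF assms]] N', symmetric])
  finally show ?thesis .
qed

lemma series_const_invariant: "series_const c \<in> invariants G"
  by (simp add: invariants_def series_const_def)

lemma series_mult_invariant:
  assumes "f \<in> invariants G" "h \<in> invariants G"
  shows "f \<otimes>\<^sub>s h \<in> invariants G"
  unfolding invariants_def
proof (intro CollectI ballI allI)
  fix g m assume g: "g \<in> G"
  show "(f \<otimes>\<^sub>s h) (image_mset g m) = (f \<otimes>\<^sub>s h) m"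
    unfolding series_mult_splits sum_splits_image[OF inj[OF g]]
    by (simp add: invariantsD[OF assms(1) g] invariantsD[OF assms(2) g])
qed

text \<open>Cutting every factor at \<open>N\<close> matches the decompositions of
  \<open>a + shift N b\<close> with pairs of a decomposition of \<open>a\<close> and one of
  \<open>b\<close>. The \<open>x\<close>-parts of all factors divide \<open>a\<close>, so the same
  \<open>N\<close> works throughout.\<close>

lemma coproduct_mult:
  assumes f: "f \<in> invariants G" and h: "h \<in> invariants G"
  shows "coproduct (f \<otimes>\<^sub>s h) = coproduct f \<otimes>\<^sub>s coproduct h"
proof (rule ext, clarify)
  fix a b :: "nat multiset"
  obtain N where N: "\<forall>i\<in>#a. i < N" using ex_bound by blast
  define low where "low = (\<lambda>c. {#i \<in># c. i < N#})"
  define high where "high = (\<lambda>c. image_mset (\<lambda>i. i - N) {#i \<in># c. \<not> i < N#})"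
  have split: "low c + shift N (high c) = c" for c
  proof -
    have "shift N (high c) = {#i \<in># c. \<not> i < N#}"
    proof -
      have "image_mset ((+) N \<circ> (\<lambda>i. i - N)) {#i \<in># c. \<not> i < N#} =
          image_mset (\<lambda>i. i) {#i \<in># c. \<not> i < N#}"
        by (rule image_mset_cong) simp
      then show ?thesis unfolding shift_def high_def multiset.map_comp by simp
    qed
    then show ?thesis unfolding low_def using multiset_partition[of c "\<lambda>i. i < N"] by simp
  qed
  have low: "low (p + shift N q) = p" and high: "high (p + shift N q) = q"
    if "\<forall>i\<in>#p. i < N" for p q
  proof -
    have "{#i \<in># p. i < N#} = p" "{#i \<in># p. \<not> i < N#} = {#}"
      using that by (auto simp: filter_mset_eq_conv)
    moreover have "{#i \<in># shift N q. i < N#} = {#}" "{#i \<in># shift N q. \<not> i < N#} = shift N q"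
      by (auto simp: filter_mset_eq_conv shift_def)
    ultimately show "low (p + shift N q) = p" "high (p + shift N q) = q"
      by (simp_all add: low_def high_def shift_def multiset.map_comp comp_def)
  qed
  have add: "low (p + q) = low p + low q" "high (p + q) = high p + high q" for p q
    by (simp_all add: low_def high_def)
  have lowN: "\<forall>i\<in>#low c. i < N" for c by (simp add: low_def)
  have "coproduct (f \<otimes>\<^sub>s h) (a, b) = (f \<otimes>\<^sub>s h) (a + shift N b)"
    by (rule coproduct_shift[OF quasi[OF series_mult_invariant[OF f h]] N])
  also have "\<dots> = (\<Sum>(p, q)\<in>splits (a + shift N b). f p * h q)"
    by (rule series_mult_splits)
  also have "\<dots> = (\<Sum>(p, q)\<in>{(p, q). p + q = (a, b)}. coproduct f p * coproduct h q)"
  proof (rule sum.reindex_bij_witness[where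
        i = "\<lambda>(p, q). (fst p + shift N (snd p), fst q + shift N (snd q))" and
        j = "\<lambda>(p, q). ((low p, high p), (low q, high q))"])
    fix x assume "x \<in> splits (a + shift N b)"
    then obtain p q where x: "x = (p, q)" "p + q = a + shift N b"
      by (auto simp: splits_def)
    have "low p + low q = a" "high p + high q = b"
      using low[OF N, of b] high[OF N, of b] by (simp_all add: x(2)[symmetric] add)
    then show "(case x of (p, q) \<Rightarrow> ((low p, high p), low q, high q)) \<in> {(p, q). p + q = (a, b)}"
      by (simp add: x(1))
    show "(case case x of (p, q) \<Rightarrow> ((low p, high p), low q, high q) of
        (p, q) \<Rightarrow> (fst p + shift N (snd p), fst q + shift N (snd q))) = x"
      by (simp add: x(1) split)
    show "(case case x of (p, q) \<Rightarrow> ((low p, high p), low q, high q) of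
        (p, q) \<Rightarrow> coproduct f p * coproduct h q) = (case x of (p, q) \<Rightarrow> f p * h q)"
      using coproduct_shift[OF quasi[OF f] lowN] coproduct_shift[OF quasi[OF h] lowN]
      by (simp add: x(1) split)
  next
    fix y assume "y \<in> {(p, q). p + q = (a, b)}"
    then obtain p q p' q' where y: "y = ((p, q), (p', q'))" "p + p' = a" "q + q' = b"
      by auto
    then have N': "\<forall>i\<in>#p. i < N" "\<forall>i\<in>#p'. i < N" using N by auto
    show "(case y of (p, q) \<Rightarrow> (fst p + shift N (snd p), fst q + shift N (snd q))) \<in> splits (a + shift N b)"
      using y by (auto simp: splits_def ac_simps)
    show "(case case y of (p, q) \<Rightarrow> (fst p + shift N (snd p), fst q + shift N (snd q)) of
        (p, q) \<Rightarrow> ((low p, high p), low q, high q)) = y"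
      using low[OF N'(1)] high[OF N'(1)] low[OF N'(2)] high[OF N'(2)] by (simp add: y(1))
  qed
  finally show "coproduct (f \<otimes>\<^sub>s h) (a, b) = (coproduct f \<otimes>\<^sub>s coproduct h) (a, b)"
    unfolding series_mult_def[of "coproduct f"] by simp
qed


text \<open>Generalised over \<open>f\<close>, because the recursion passes to slices. Renaming a
  monomial renames its splits, and the slices at \<open>b\<close> and at
  \<open>image_mset g b\<close> coincide.\<close>

lemma antipode_invariant:
  assumes "f \<in> invariants G"
  shows "antipode f \<in> invariants G"
proof -
  have "antipode f (image_mset g m) = antipode f m" if g: "g \<in> G" for g m
    using assms
  proof (induction "size m" arbitrary: f m rule: less_induct)
    case less
    have "antipode (\<lambda>a. coproduct f (a, image_mset g b)) (image_mset g a) =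
        antipode (\<lambda>a. coproduct f (a, b)) a" if "(a, b) \<in> splits m" "b \<noteq> {#}" for a b
    proof -
      have "size a < size m" using that by (auto simp: splits_def nonempty_has_size)
      moreover have "coproduct f (a, image_mset g b) = coproduct f (a, b)" for a
        using coproduct_invariant[OF less.prems] g by (simp add: invariants2_def)
      ultimately show ?thesis
        using less.hyps[OF _ left_slice[OF less.prems]] by simp
    qed
    then show ?case
      unfolding antipode_eq[of f] sum_splits_image[OF inj[OF g]]
      by (intro arg_cong2[where f = "(-)"] sum.cong) auto
  qed
  then show ?thesis by (simp add: invariants_def)
qed

text \<open>
  Expanding the recursions at both ends, \<open>antipode\<close> and \<open>coantipode\<close> become the same sum over
  decompositions of a monomial into three factors of which the outer two are nontrivial.
\<close>

lemma antipode_eq_coantipode: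
  assumes "f \<in> invariants G"
  shows "antipode f = coantipode f"
proof (rule ext)
  fix m
  show "antipode f m = coantipode f m"
    using assms
  proof (induction "size m" arbitrary: f m rule: less_induct)
    case less
    note f = less.prems
    show ?case
    proof (cases "m = {#}")
      case True
      then show ?thesis by (simp add: antipode_empty coantipode_empty)
    next
      case False
      \<comment> \<open>\<open>H c b\<close> is the middle slice of the threefold coproduct, with
        \<open>c\<close> in the first and \<open>b\<close> in the third alphabet; by coassociativity
        either end may be cut off first.\<close>
      define H where "H = (\<lambda>c b d. coproduct (\<lambda>a. coproduct f (a, b)) (c, d))"
      have H: "H c b = (\<lambda>d. coproduct (\<lambda>d. coproduct f (c, d)) (d, b))" for c b
        unfolding H_def using coproduct_coassoc[OF f] by blast
      have H_inv: "H c b \<in> invariants G" for c b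
        unfolding H_def by (intro right_slice left_slice f)
      have left: "antipode (\<lambda>a. coproduct f (a, b)) a =
          - coproduct f (a, b) - (\<Sum>(c, d)\<in>proper_splits a. antipode (H c b) d)"
        if "(a, b) \<in> proper_splits m" for a b
      proof -
        have a: "size a < size m" "a \<noteq> {#}"
          using that by (auto simp: proper_splits_def nonempty_has_size)
        \<comment> \<open>Changing to \<open>coantipode\<close> allows the left end to be split off;
          the induction hypothesis then returns to \<open>antipode\<close> on the middle
          factor.\<close>
        have "antipode (\<lambda>a. coproduct f (a, b)) a = coantipode (\<lambda>a. coproduct f (a, b)) a"
          by (rule less.hyps[OF a(1) left_slice[OF f]])
        also have "\<dots> = - coproduct f (a, b) - (\<Sum>(c, d)\<in>proper_splits a. coantipode (H c b) d)"
          by (simp add: coantipode_proper[OF a(2)] H_def)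
        also have "(\<Sum>(c, d)\<in>proper_splits a. coantipode (H c b) d) =
            (\<Sum>(c, d)\<in>proper_splits a. antipode (H c b) d)"
        proof (intro sum.cong refl, clarify)
          fix c d assume "(c, d) \<in> proper_splits a"
          then have "size d < size m" using a(1) by (auto simp: proper_splits_def)
          then show "coantipode (H c b) d = antipode (H c b) d"
            using less.hyps[OF _ H_inv] by simp
        qed
        finally show ?thesis .
      qed
      have right: "coantipode (\<lambda>b. coproduct f (a, b)) b =
          - coproduct f (a, b) - (\<Sum>(d, e)\<in>proper_splits b. antipode (H a e) d)"
        if "(a, b) \<in> proper_splits m" for a b
      proof -
        have b: "size b < size m" "b \<noteq> {#}"
          using that by (auto simp: proper_splits_def nonempty_has_size)
        have "coantipode (\<lambda>b. coproduct f (a, b)) b = antipode (\<lambda>b. coproduct f (a, b)) b"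
          by (rule less.hyps[OF b(1) right_slice[OF f], symmetric])
        then show ?thesis by (simp add: antipode_proper[OF b(2)] H)
      qed
      \<comment> \<open>Both sides run over the decompositions of \<open>m\<close> into three
        nontrivial factors, bracketed differently.\<close>
      have "(\<Sum>(a, b)\<in>proper_splits m. \<Sum>(c, d)\<in>proper_splits a. antipode (H c b) d) =
          (\<Sum>(a, b)\<in>proper_splits m. \<Sum>(d, e)\<in>proper_splits b. antipode (H a e) d)"
        unfolding case_prod_unfold
      proof (subst (1 2) sum.Sigma, (simp add: finite_proper_splits)+,
          rule sum.reindex_bij_witness[where
            i = "\<lambda>((a, b), (d, e)). ((a + d, e), (a, d))" and
            j = "\<lambda>((a, b), (c, d)). ((c, d + b), (d, b))"])
      qed (auto simp: proper_splits_def add.assoc)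
      then have "(\<Sum>(a, b)\<in>proper_splits m. antipode (\<lambda>a. coproduct f (a, b)) a) =
          (\<Sum>(a, b)\<in>proper_splits m. coantipode (\<lambda>b. coproduct f (a, b)) b)"
        using left right by (simp add: case_prod_unfold sum_subtractf)
      then show ?thesis
        by (simp add: antipode_proper[OF False] coantipode_proper[OF False])
    qed
  qed
qed

section \<open>Hopf algebras whose elements are the invariant series\<close>

context
  fixes M :: "'i based_space"
  assumes space: "space_of M = invariants G" and tensor: "tensor_square M = invariants2 G"
begin

lemma is_antipode_antipode: "is_antipode M antipode"
proof -
  have "codiagonal (tensor_id antipode (coproduct f)) = series_const (counit f)" for f
    by (rule ext) (simp add: codiagonal_splits tensor_id_def antipode_left)
  \<comment> \<open>The right identity is built into \<open>coantipode\<close>, which agrees with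
    \<open>antipode\<close> on every slice because slices are invariant.\<close>
  moreover have "codiagonal (id_tensor antipode (coproduct f)) = series_const (counit f)"
    if f: "f \<in> invariants G" for f
    using antipode_eq_coantipode[OF right_slice[OF f]]
    by (intro ext) (simp add: codiagonal_splits id_tensor_def coantipode_right)
  ultimately show ?thesis
    unfolding is_antipode_def continuous_linear_on_def space
    using antipode_invariant antipode_add continuous_on_subset[OF continuous_antipode] by blast
qed

text \<open>The left identity determines \<open>S f\<close> at \<open>m\<close> from values of
  \<open>S\<close> at smaller monomials, since its term with empty second factor is
  \<open>S f m\<close>. This reduces every claim about arbitrary antipodes to the explicit
  recursion.\<close>

lemma antipode_unique:
  assumes S: "is_antipode M S" and "f \<in> invariants G"
  shows "S f = antipode f"
proof (rule ext)
  fix m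
  show "S f m = antipode f m"
    using assms(2)
  proof (induction "size m" arbitrary: f m rule: less_induct)
    case less
    have split: "splits m = insert (m, {#}) {p \<in> splits m. snd p \<noteq> {#}}"
      by (auto simp: splits_def)
    have "codiagonal (tensor_id S (coproduct f)) m = series_const (counit f) m"
      using S less.prems unfolding is_antipode_def space by simp
    then have "(\<Sum>(a, b)\<in>splits m. S (\<lambda>a. coproduct f (a, b)) a) =
        (\<Sum>(a, b)\<in>splits m. antipode (\<lambda>a. coproduct f (a, b)) a)"
      by (simp add: codiagonal_splits tensor_id_def antipode_left)
    moreover have "(\<Sum>(a, b)\<in>{p \<in> splits m. snd p \<noteq> {#}}. S (\<lambda>a. coproduct f (a, b)) a) =
        (\<Sum>(a, b)\<in>{p \<in> splits m. snd p \<noteq> {#}}. antipode (\<lambda>a. coproduct f (a, b)) a)"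
    proof (intro sum.cong refl, clarify)
      fix a b assume "(a, b) \<in> splits m" "snd (a, b) \<noteq> {#}"
      then have "size a < size m" by (auto simp: splits_def nonempty_has_size)
      then show "S (\<lambda>a. coproduct f (a, b)) a = antipode (\<lambda>a. coproduct f (a, b)) a"
        by (rule less.hyps[OF _ left_slice[OF less.prems]])
    qed
    ultimately show ?case
      by (subst (asm) (1 2) split) (simp add: finite_splits coproduct_counit)
  qed
qed

lemma hopf_algebra: "hopf_algebra M"
  unfolding hopf_algebra_def space tensor
proof (intro conjI ballI allI)
  show "coproduct (series_const 1) = series_const 1"
    by (auto simp: coproduct_def series_const_def fun_eq_iff zero_prod_def)
  show "counit (f \<otimes>\<^sub>s g) = counit f * counit g" for f g
    by (simp add: counit_def series_mult_splits splits_empty)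
  show "\<exists>S. is_antipode M S"
    using is_antipode_antipode by blast
qed (simp_all add: series_const_invariant series_mult_invariant coproduct_invariant
    tensor_id_def id_tensor_def coproduct_coassoc coproduct_mult counit_def coproduct_counit
    counit_coproduct, simp add: series_const_def)

end

end

theorem proposition6p4:
  shows "hopf_subalgebra mSym mQSym \<and> hopf_isomorphic mSym Sym_hat"
proof
  have sub: "symmetric \<subseteq> quasisymmetric"
    using sym.quasi by blast
  \<comment> \<open>Symmetric series are quasisymmetric, so on them \<open>S\<close> is given by the
    same recursion, which preserves symmetry.\<close>
  have "S ` symmetric \<subseteq> symmetric" if "is_antipode mQSym S" for S
    using quasi.antipode_unique[OF space_mQSym tensor_square_mQSym that] sym.antipode_invariant sub by fastforce
  then show "hopf_subalgebra mSym mQSym"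
    unfolding hopf_subalgebra_def space_mSym space_mQSym tensor_square_mSym
    using quasi.hopf_algebra[OF space_mQSym tensor_square_mQSym] sub
      sym.series_const_invariant sym.series_mult_invariant sym.coproduct_invariant by blast
  \<comment> \<open>The antipodes of the two sides are arbitrary here; uniqueness shows that they
    agree on symmetric series.\<close>
  have "hopf_isomorphism mSym Sym_hat (\<lambda>f. f)"
    unfolding hopf_isomorphism_def space_mSym space_Sym_hat continuous_linear_on_def
    using sym.antipode_unique[OF space_mSym tensor_square_mSym]
      sym.antipode_unique[OF space_Sym_hat tensor_square_Sym_hat]
      homeomorphism_ident[of symmetric]
    by (auto simp: tensor_id_def id_tensor_def case_prod_unfold)
  then show "hopf_isomorphic mSym Sym_hat"
    unfolding hopf_isomorphic_def
    using sym.hopf_algebra[OF space_mSym tensor_square_mSym]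
      sym.hopf_algebra[OF space_Sym_hat tensor_square_Sym_hat] by blast
qed

end
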